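(* Assume that $E=I_n+BK_DC$ is nonsingular. The following statements hold. 1. If $A_{\rm id}$ is Hurwitz and $\rho(M_D)<1$, then there exists $h^\star>0$ such that $\mathcal A_h$ is Schur for every $h\in(0,h^\star)$. 2. If $A_{\rm id}$ has an eigenvalue with positive real part, or if $M_D$ has an eigenvalue with modulus greater than one, then for all sufficiently small $h>0$ the matrix $\mathcal A_h$ is not Schur (that is, there exists $h_0>0$ such that $\mathcal A_h$ is not Schur for every $h\in(0,h_0)$). 3. Suppose, in addition, that $A_{\rm id}$ has no eigenvalues on the imaginary axis and $M_D$ has no eigenvalues on the unit circle. Then there exists $h^\star>0$ such that $\mathcal A_h$ is Schur for every $h\in(0,h^\star)$ if and only if $A_{\rm id}$ is Hurwitz and $\rho(M_D)<1$.
   Context: Fix positive integers $n,m,p$ and real matrices $A\in\mathbb R^{n\times n}$, $B\in\mathbb R^{n\times m}$, $C\in\mathbb R^{p\times n}$ (the plant $\dot x=Ax+Bu$, $y=Cx$) and gains $K_P,K_I,K_D\in\mathbb R^{m\times p}$. Set $E=I_n+BK_DC$ and $M_D=CBK_D\in\mathbb R^{p\times p}$. When $E$ is nonsingular, the ideal PID closed-loop matrix is $$A_{\rm id}=\begin{bmatrix}E^{-1}(A-BK_PC)&-E^{-1}BK_I\\ C&0\end{bmatrix}\in\mathbb R^{(n+p)\times(n+p)}.$$ For a sampling period $h>0$, let $\Phi_h=e^{Ah}$ and $\Gamma_h=\int_0^h e^{A\tau}\,d\tau$, and define the lifted matrix of the sampled PID implementation with backward differences $$\mathcal A_h=\begin{bmatrix}\Phi_h-\Gamma_hB(K_P+h^{-1}K_D)C&-\Gamma_hBK_I&h^{-1}\Gamma_hBK_D\\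 hC&I_p&0\\ C&0&0\end{bmatrix}\in\mathbb R^{(n+2p)\times(n+2p)}.$$ Eigenvalues are taken in $\mathbb C$; $\rho(\cdot)$ denotes the spectral radius. A square matrix is called Hurwitz if all its eigenvalues have negative real parts, and Schur if all its eigenvalues lie in the open unit disk. *)

theory Defs
  imports
    "HOL-Analysis.Analysis"
    "Jordan_Normal_Form.Spectral_Radius"
    "Jordan_Normal_Form.Gauss_Jordan_Elimination"
begin

text \<open>The type of matrices of arbitrary dimension carries no topology, so the exponential series
  and the integral are taken entrywise, which is the usual notion in finite dimension.\<close>

definition mat_exp :: "real mat \<Rightarrow> real mat" where
  "mat_exp A = mat (dim_row A) (dim_col A) (\<lambda>(i, j). \<Sum>k. (A ^\<^sub>m k) $$ (i, j) / fact k)"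

definition Phi :: "real mat \<Rightarrow> real \<Rightarrow> real mat" where
  "Phi A h = mat_exp (h \<cdot>\<^sub>m A)"

definition Gamma :: "real mat \<Rightarrow> real \<Rightarrow> real mat" where
  "Gamma A h = mat (dim_row A) (dim_col A)
     (\<lambda>(i, j). integral {0..h} (\<lambda>\<tau>. mat_exp (\<tau> \<cdot>\<^sub>m A) $$ (i, j)))"

definition E_mat :: "real mat \<Rightarrow> real mat \<Rightarrow> real mat \<Rightarrow> real mat" where
  "E_mat B C KD = 1\<^sub>m (dim_row B) + B * KD * C"

definition M_D :: "real mat \<Rightarrow> real mat \<Rightarrow> real mat \<Rightarrow> real mat" where
  "M_D B C KD = C * B * KD"

text \<open>\<open>mat_inverse\<close> returns an option; the value below is the inverse of \<open>E\<close> whenever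
  \<open>E\<close> is nonsingular and is unspecified otherwise.\<close>

definition A_id ::
  "real mat \<Rightarrow> real mat \<Rightarrow> real mat \<Rightarrow> real mat \<Rightarrow> real mat \<Rightarrow> real mat \<Rightarrow> real mat" where
  "A_id A B C KP KI KD =
     (let Einv = the (mat_inverse (E_mat B C KD)); p = dim_row C in
      four_block_mat
        (Einv * (A - B * KP * C)) (- (Einv * B * KI))
        C                         (0\<^sub>m p p))"

text \<open>The 3-by-3 block matrix is assembled as a 2-by-2 one whose leading block has size
  \<open>n + p\<close>. The last column above the corner is stacked with \<open>append_rows\<close>; the last row
  \<open>[C 0]\<close> left of the corner is a block matrix whose lower blocks have no rows.\<close>

definition A_lift ::
  "real mat \<Rightarrow> real mat \<Rightarrow> real mat \<Rightarrow> real mat \<Rightarrow> real mat \<Rightarrow> real mat \<Rightarrow> real \<Rightarrow> real mat" where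
  "A_lift A B C KP KI KD h =
     (let G = Gamma A h; n = dim_row A; p = dim_row C in
      four_block_mat
        (four_block_mat
           (Phi A h - G * B * (KP + inverse h \<cdot>\<^sub>m KD) * C) (- (G * B * KI))
           (h \<cdot>\<^sub>m C)                                       (1\<^sub>m p))
        (inverse h \<cdot>\<^sub>m (G * B * KD) @\<^sub>r 0\<^sub>m p p)
        (four_block_mat C (0\<^sub>m p p) (0\<^sub>m 0 n) (0\<^sub>m 0 p))
        (0\<^sub>m p p))"

abbreviation cmat :: "real mat \<Rightarrow> complex mat" where
  "cmat \<equiv> map_mat complex_of_real"

definition hurwitz :: "real mat \<Rightarrow> bool" where
  "hurwitz M \<longleftrightarrow> (\<forall>\<mu>. eigenvalue (cmat M) \<mu> \<longrightarrow> Re \<mu> < 0)"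

definition schur :: "real mat \<Rightarrow> bool" where
  "schur M \<longleftrightarrow> (\<forall>\<mu>. eigenvalue (cmat M) \<mu> \<longrightarrow> cmod \<mu> < 1)"

end

theory Submission
  imports Defs "HOL-Complex_Analysis.Great_Picard"
begin

text \<open>Let \<open>z \<noteq> 0\<close> be an eigenvalue of the lifted matrix with eigenvector \<open>(x, u, w)\<close>. The last block row says
\<open>w = C x / z\<close>, so the stored output can be eliminated. Writing \<open>\<Gamma>\<^sub>h = h G\<^sub>h\<close>, where \<open>G\<^sub>h\<close> is a
power series in \<open>h A\<close> with \<open>G\<^sub>0 = I\<close>, and using \<open>\<Phi>\<^sub>h = I + h G\<^sub>h A\<close>, the remaining two rows become
\<open>(1 - y) \<xi> + diag(G\<^sub>h, I) ((1 - y) y L - h y R) \<xi> = 0\<close> with \<open>\<xi> = (x, u)\<close>, \<open>y = 1 / z\<close> and the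
constant matrices \<open>L = [B K\<^sub>D C, 0; 0, 0]\<close> and \<open>R = [A - B K\<^sub>P C, - B K\<^sub>I; C, 0]\<close>.
All powers \<open>1/h\<close> have disappeared, so the limit \<open>h = 0\<close> can be taken.
Working with \<open>y\<close> has a second benefit: the eigenvalues that violate the Schur property fill the
punctured closed unit disk, which is bounded.

The two limit matrices are the two ways in which the coefficients \<open>(1 - y, h y)\<close> can degenerate.
If \<open>1 - y\<close> dominates, the equation tends to \<open>det (I + y L) = 0\<close>, which says that \<open>- 1 / y\<close> is an
eigenvalue of \<open>M\<^sub>D\<close>: these are fast eigenvalues \<open>z \<approx> - \<mu>\<close>. If \<open>1 - y\<close> and \<open>h y\<close> are comparable, then
\<open>z = 1 + h s\<close> with bounded \<open>s\<close>, and the equation tends to \<open>det (s (I + L) - R) = 0\<close>; since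
\<open>I + L = diag(E, I)\<close> and \<open>(I + L) A\<^sub>i\<^sub>d = R\<close>, this says that \<open>s\<close> is an eigenvalue of \<open>A\<^sub>i\<^sub>d\<close>.

For stability (\<open>pencil_no_zero\<close>), violating eigenvalues along \<open>h \<rightarrow> 0\<close> are normalised so that the
coefficient pair has length one and a convergent subsequence is taken; its limit is a zero of one
of the two limit equations, and the limit of \<open>\<bar>1 + h s\<bar> \<ge> 1\<close> is \<open>Re s \<ge> 0\<close>. For instability
(\<open>pencil_slow_zero\<close>, \<open>pencil_fast_zero\<close>), Hurwitz's theorem on zeros of locally uniform limits
moves an unstable zero of a limit equation to zeros for all small \<open>h\<close>. The third claim combines
the first two, because the assumption excludes the borderline cases.\<close>

unbundle no vec_syntax
hide_const (open) Determinants.det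

section \<open>Zeros of a continuous family of holomorphic functions\<close>

text \<open>If there were zero-free members \<open>F (H k)\<close> with \<open>H k \<rightarrow> 0\<close>, then joint continuity would make them
converge to \<open>F 0\<close> uniformly on compact sets, and Hurwitz's theorem would forbid the zero of \<open>F 0\<close>.\<close>
lemma Hurwitz_zero_persistence:
  fixes F :: "real \<Rightarrow> complex \<Rightarrow> complex"
  assumes S: "open S" "connected S"
    and cont: "continuous_on ({0..1} \<times> S) (\<lambda>(h, s). F h s)"
    and hol: "\<And>h. 0 \<le> h \<Longrightarrow> F h holomorphic_on S"
    and nonconst: "\<not> F 0 constant_on S"
    and zero: "s0 \<in> S" "F 0 s0 = 0"
  shows "\<exists>h0>0. \<forall>h\<in>{0<..<h0}. \<exists>s\<in>S. F h s = 0"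
proof (rule ccontr)
  assume contra: "\<not> ?thesis"
  have "\<exists>h. h \<in> {0<..<inverse (real (Suc k))} \<and> (\<forall>s\<in>S. F h s \<noteq> 0)" for k
    using contra by (meson inverse_positive_iff_positive of_nat_0_less_iff zero_less_Suc)
  then obtain H where H: "\<And>k. H k \<in> {0<..<inverse (real (Suc k))}"
    and nz: "\<And>k s. s \<in> S \<Longrightarrow> F (H k) s \<noteq> 0"
    by metis
  have H01: "H k \<in> {0..1}" for k
  proof -
    have "inverse (real (Suc k)) \<le> 1"
      by (simp add: inverse_le_1_iff)
    then show ?thesis using H[of k] by auto
  qed
  have H0: "H \<longlonglongrightarrow> 0"
    by (rule tendsto_sandwich[OF _ _ tendsto_const LIMSEQ_inverse_real_of_nat])
      (use H in \<open>auto intro!: always_eventually less_imp_le\<close>)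
  have unif: "uniform_limit K (\<lambda>k. F (H k)) (F 0) sequentially"
    if K: "compact K" "K \<subseteq> S" for K
  proof (rule uniform_limitI)
    fix e :: real assume "e > 0"
    have "uniformly_continuous_on ({0..1} \<times> K) (\<lambda>(h, s). F h s)"
      by (intro compact_uniformly_continuous compact_Times K compact_Icc continuous_on_subset[OF cont])
        (use K in auto)
    then obtain d where d: "d > 0" and
      dd: "\<And>x x'. x \<in> {0..1} \<times> K \<Longrightarrow> x' \<in> {0..1} \<times> K \<Longrightarrow> dist x' x < d
        \<Longrightarrow> dist ((\<lambda>(h, s). F h s) x') ((\<lambda>(h, s). F h s) x) < e"
      unfolding uniformly_continuous_on_def using \<open>e > 0\<close> by metis
    have "\<forall>\<^sub>F k in sequentially. dist (H k) 0 < d"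
      using H0 d by (rule tendstoD)
    then show "\<forall>\<^sub>F k in sequentially. \<forall>s\<in>K. dist (F (H k) s) (F 0 s) < e"
    proof eventually_elim
      case (elim k)
      show ?case
        using dd[of "(0, s)" "(H k, s)" for s] H01[of k] elim by (auto simp: dist_Pair_Pair)
    qed
  qed
  have "F 0 s0 \<noteq> 0"
    by (rule Hurwitz_no_zeros[OF S, of "\<lambda>k. F (H k)"])
      (use hol H01 nz zero nonconst unif in auto)
  with zero show False by simp
qed

section \<open>Determinants of the two-scale pencil\<close>

text \<open>The coefficients \<open>a\<close> and \<open>b\<close> are kept as a homogeneous pair: only their ratio matters for the
vanishing of the determinant, and \<open>b = 0\<close> is the fast limit \<open>a / b = \<infinity>\<close>.\<close>
definition pencil ::
  "complex mat \<Rightarrow> complex mat \<Rightarrow> complex mat \<Rightarrow> complex \<Rightarrow> complex \<Rightarrow> complex \<Rightarrow> complex mat" where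
  "pencil G L R y a b = a \<cdot>\<^sub>m 1\<^sub>m (dim_row G) + G * ((a * y) \<cdot>\<^sub>m L - b \<cdot>\<^sub>m R)"

lemma pencil_carrier [simp]:
  assumes "G \<in> carrier_mat N N" "L \<in> carrier_mat N N" "R \<in> carrier_mat N N"
  shows "pencil G L R y a b \<in> carrier_mat N N"
  using assms unfolding pencil_def by auto

text \<open>The Leibniz formula exhibits the determinant as a polynomial in \<open>y\<close>, \<open>a\<close>, \<open>b\<close> and the entries of \<open>G\<close>,
from which continuity and holomorphy can be read off without a topology on matrices.\<close>
lemma det_pencil_expand:
  assumes "G \<in> carrier_mat N N" "L \<in> carrier_mat N N" "R \<in> carrier_mat N N"
  shows "det (pencil G L R y a b) =
    (\<Sum>\<pi> | \<pi> permutes {0..<N}. signof \<pi> * (\<Prod>i = 0..<N. a * (if i = \<pi> i then 1 else 0)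
       + (\<Sum>l = 0..<N. G $$ (i, l) * (a * y * L $$ (l, \<pi> i) - b * R $$ (l, \<pi> i)))))"
proof -
  have entry: "pencil G L R y a b $$ (i, j) = a * (if i = j then 1 else 0)
       + (\<Sum>l = 0..<N. G $$ (i, l) * (a * y * L $$ (l, j) - b * R $$ (l, j)))"
    if "i < N" "j < N" for i j
    using assms that unfolding pencil_def by (simp add: scalar_prod_def)
  show ?thesis
    unfolding Determinant.det_def'[OF pencil_carrier[OF assms]]
  proof (intro sum.cong refl)
    fix \<pi> assume "\<pi> \<in> {\<pi>. \<pi> permutes {0..<N}}"
    then have "\<pi> i < N" if "i < N" for i
      using permutes_in_image[of \<pi> "{0..<N}" i] that by simp
    then show "signof \<pi> * (\<Prod>i = 0..<N. pencil G L R y a b $$ (i, \<pi> i)) =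
      signof \<pi> * (\<Prod>i = 0..<N. a * (if i = \<pi> i then 1 else 0)
       + (\<Sum>l = 0..<N. G $$ (i, l) * (a * y * L $$ (l, \<pi> i) - b * R $$ (l, \<pi> i))))"
      by (simp add: entry)
  qed
qed

lemma det_pencil_scale:
  assumes "G \<in> carrier_mat N N" "L \<in> carrier_mat N N" "R \<in> carrier_mat N N"
  shows "det (pencil G L R y (c * a) (c * b)) = c ^ N * det (pencil G L R y a b)"
proof -
  have "pencil G L R y (c * a) (c * b) = c \<cdot>\<^sub>m pencil G L R y a b"
    using assms unfolding pencil_def
    by (intro eq_matI) (auto simp: scalar_prod_def algebra_simps sum_distrib_left)
  then show ?thesis
    by (simp add: det_smult carrier_matD(2)[OF pencil_carrier[OF assms]])
qed

lemma det_pencil_fast_0: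
  assumes "G \<in> carrier_mat N N" "L \<in> carrier_mat N N" "R \<in> carrier_mat N N"
  shows "det (pencil G L R 0 1 0) = 1"
proof -
  have "pencil G L R 0 1 0 = 1\<^sub>m N"
    using assms unfolding pencil_def by (intro eq_matI) (auto simp: scalar_prod_def)
  then show ?thesis by simp
qed

lemma continuous_on_det_pencil:
  fixes S :: "'a::t2_space set"
  assumes "\<And>x. G x \<in> carrier_mat N N" "L \<in> carrier_mat N N" "R \<in> carrier_mat N N"
    and "\<And>i j. i < N \<Longrightarrow> j < N \<Longrightarrow> continuous_on S (\<lambda>x. G x $$ (i, j))"
    and "continuous_on S y" "continuous_on S a" "continuous_on S b"
  shows "continuous_on S (\<lambda>x. det (pencil (G x) L R (y x) (a x) (b x)))"
  unfolding det_pencil_expand[OF assms(1-3)]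
  by (intro continuous_on_sum continuous_on_prod continuous_on_mult continuous_on_add
      continuous_on_diff continuous_on_const assms(4-)) auto

lemma holomorphic_on_det_pencil:
  assumes "G \<in> carrier_mat N N" "L \<in> carrier_mat N N" "R \<in> carrier_mat N N"
    and "y holomorphic_on S" "a holomorphic_on S" "b holomorphic_on S"
  shows "(\<lambda>s. det (pencil G L R (y s) (a s) (b s))) holomorphic_on S"
  unfolding det_pencil_expand[OF assms(1-3)]
  by (intro holomorphic_on_sum holomorphic_on_prod holomorphic_on_mult holomorphic_on_add
      holomorphic_on_diff holomorphic_on_const assms(4-))

text \<open>With \<open>y = 1 / (1 + h s)\<close> the coefficient pair is \<open>h y (s, 1)\<close>, so after scaling the determinant is
holomorphic in \<open>s\<close> on the right half-plane, where \<open>1 + h s\<close> does not vanish and \<open>\<bar>y\<bar> < 1\<close> for \<open>h > 0\<close>.\<close>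
lemma pencil_slow_zero:
  assumes G: "\<And>h. G h \<in> carrier_mat N N" and L: "L \<in> carrier_mat N N" and R: "R \<in> carrier_mat N N"
    and contG: "\<And>i j. i < N \<Longrightarrow> j < N \<Longrightarrow> continuous_on UNIV (\<lambda>h::real. G h $$ (i, j))"
    and nonsing: "det (pencil (G 0) L R 1 1 0) \<noteq> 0"
    and zero: "det (pencil (G 0) L R 1 s0 1) = 0" "Re s0 > 0"
  shows "\<exists>h0>0. \<forall>h\<in>{0<..<h0}. \<exists>y. y \<noteq> 0 \<and> cmod y < 1 \<and>
    det (pencil (G h) L R y (1 - y) (complex_of_real h * y)) = 0"
proof -
  define F where "F h s = det (pencil (G h) L R (1 / (1 + complex_of_real h * s)) s 1)"
    for h s
  let ?S = "{s. Re s > 0}"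
  have big: "cmod (1 + complex_of_real h * s) \<ge> 1 + h * Re s" for h s
    using complex_Re_le_cmod[of "1 + complex_of_real h * s"] by simp
  have nz: "1 + complex_of_real h * s \<noteq> 0" if "h \<ge> 0" "s \<in> ?S" for h s
  proof -
    have "h * Re s \<ge> 0" using that by auto
    with big[of h s] have "cmod (1 + complex_of_real h * s) > 0" by linarith
    then show ?thesis by simp
  qed
  have "\<exists>h0>0. \<forall>h\<in>{0<..<h0}. \<exists>s\<in>?S. F h s = 0"
  proof (rule Hurwitz_zero_persistence)
    show "open ?S" by (rule open_halfspace_Re_gt)
    show "connected ?S" by (simp add: convex_connected convex_halfspace_Re_gt)
    show "continuous_on ({0..1} \<times> ?S) (\<lambda>(h, s). F h s)"
      unfolding F_def case_prod_unfold
      by (rule continuous_on_det_pencil[OF G L R])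
        (use nz in \<open>auto intro!: continuous_intros continuous_on_compose2[OF contG]\<close>)
    show "F h holomorphic_on ?S" if "0 \<le> h" for h
      unfolding F_def
      by (rule holomorphic_on_det_pencil[OF G L R])
        (use nz that in \<open>auto intro!: holomorphic_intros\<close>)
    show "s0 \<in> ?S" "F 0 s0 = 0" using zero by (auto simp: F_def)
    show "\<not> F 0 constant_on ?S"
    proof -
      \<comment> \<open>for large real \<open>s\<close>, the determinant is \<open>s ^ N\<close> times a small perturbation of a nonzero number\<close>
      let ?g = "\<lambda>b::real. det (pencil (G 0) L R 1 1 (complex_of_real b))"
      have "continuous_on UNIV ?g"
        by (rule continuous_on_det_pencil[OF G L R]) (auto intro!: continuous_intros)
      then have "isCont ?g 0" by (simp add: continuous_on_eq_continuous_at)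
      then have "(?g \<longlongrightarrow> ?g 0) (at_right 0)"
        unfolding isCont_def by (rule filterlim_mono) (auto simp: at_within_le_at)
      then have "\<forall>\<^sub>F b in at_right 0. ?g b \<noteq> 0"
        by (rule tendsto_imp_eventually_ne) (use nonsing in simp)
      then obtain b0 :: real where "b0 > 0" and "\<And>b. 0 < b \<Longrightarrow> b < b0 \<Longrightarrow> ?g b \<noteq> 0"
        unfolding eventually_at_right_field by auto
      then obtain b where b: "b > 0" "?g b \<noteq> 0"
        by (meson dense)
      have "F 0 (complex_of_real (1 / b)) = complex_of_real (1 / b) ^ N * ?g b"
        unfolding F_def using det_pencil_scale[OF G L R, of 0 1 "complex_of_real (1 / b)" 1 "complex_of_real b"] b
        by simp
      then have "F 0 (complex_of_real (1 / b)) \<noteq> F 0 s0"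
        using b \<open>F 0 s0 = 0\<close> by simp
      then show ?thesis
        unfolding constant_on_def using b zero
        by (metis Re_complex_of_real mem_Collect_eq zero_less_divide_1_iff)
    qed
  qed
  then obtain h0 where h0: "h0 > 0" "\<And>h. h \<in> {0<..<h0} \<Longrightarrow> \<exists>s\<in>?S. F h s = 0" by blast
  show ?thesis
  proof (intro exI[of _ h0] conjI ballI h0(1))
    fix h assume h: "h \<in> {0<..<h0}"
    then obtain s where s: "Re s > 0" "F h s = 0" using h0(2) by auto
    define y where "y = 1 / (1 + complex_of_real h * s)"
    have nzs: "1 + complex_of_real h * s \<noteq> 0" using nz[of h s] h s by auto
    have "h * Re s > 0" using h s by simp
    then have "cmod (1 + complex_of_real h * s) > 1" using big[of h s] by linarith
    then have "cmod y < 1" by (auto simp: y_def norm_divide divide_less_eq)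
    moreover have "y \<noteq> 0" using nzs by (simp add: y_def)
    moreover have "1 - y = (complex_of_real h * y) * s"
      using nzs by (simp add: y_def field_simps)
    then have "det (pencil (G h) L R y (1 - y) (complex_of_real h * y)) = 0"
      using det_pencil_scale[OF G L R, of h y "complex_of_real h * y" s 1] s(2)
      by (simp add: F_def y_def)
    ultimately show "\<exists>y. y \<noteq> 0 \<and> cmod y < 1 \<and>
       det (pencil (G h) L R y (1 - y) (complex_of_real h * y)) = 0" by blast
  qed
qed

text \<open>At \<open>h = 0\<close> the coefficient pair is \<open>(1 - y) (1, 0)\<close>, so a zero of the fast limit is a zero of the
limit function on the open unit disk. The value 1 at \<open>y = 0\<close>, for every \<open>h\<close>, shows both that the limit function is
not constant and that the zeros found are nonzero.\<close>
lemma pencil_fast_zero: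
  assumes G: "\<And>h. G h \<in> carrier_mat N N" and L: "L \<in> carrier_mat N N" and R: "R \<in> carrier_mat N N"
    and contG: "\<And>i j. i < N \<Longrightarrow> j < N \<Longrightarrow> continuous_on UNIV (\<lambda>h::real. G h $$ (i, j))"
    and zero: "det (pencil (G 0) L R y0 1 0) = 0" "cmod y0 < 1"
  shows "\<exists>h0>0. \<forall>h\<in>{0<..<h0}. \<exists>y. y \<noteq> 0 \<and> cmod y < 1 \<and>
    det (pencil (G h) L R y (1 - y) (complex_of_real h * y)) = 0"
proof -
  define F where "F h y = det (pencil (G h) L R y (1 - y) (complex_of_real h * y))"
    for h y
  have at_0: "F h 0 = 1" for h
    using det_pencil_fast_0[OF G L R] by (simp add: F_def)
  have zeroF: "F 0 y0 = 0"
    using det_pencil_scale[OF G L R, of 0 y0 "1 - y0" 1 0] zero by (simp add: F_def)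
  have "\<exists>h0>0. \<forall>h\<in>{0<..<h0}. \<exists>y\<in>ball 0 1. F h y = 0"
  proof (rule Hurwitz_zero_persistence)
    show "continuous_on ({0..1} \<times> ball 0 1) (\<lambda>(h, y). F h y)"
      unfolding F_def case_prod_unfold
      by (rule continuous_on_det_pencil[OF G L R])
        (auto intro!: continuous_intros continuous_on_compose2[OF contG])
    show "F h holomorphic_on ball 0 1" for h
      unfolding F_def
      by (rule holomorphic_on_det_pencil[OF G L R]) (auto intro!: holomorphic_intros)
    show "\<not> F 0 constant_on ball 0 1"
    proof
      assume "F 0 constant_on ball 0 1"
      then obtain c where "\<And>y. y \<in> ball 0 1 \<Longrightarrow> F 0 y = c" unfolding constant_on_def by blast
      from this[of 0] this[of y0] show False using at_0 zeroF zero by simp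
    qed
  qed (use zero zeroF in auto)
  then obtain h0 where "h0 > 0" and h0: "\<And>h. h \<in> {0<..<h0} \<Longrightarrow> \<exists>y\<in>ball 0 1. F h y = 0" by blast
  show ?thesis
  proof (intro exI[of _ h0] conjI ballI \<open>h0 > 0\<close>)
    fix h assume "h \<in> {0<..<h0}"
    then obtain y where "cmod y < 1" "F h y = 0" using h0 by force
    moreover from this have "y \<noteq> 0" using at_0[of h] by auto
    ultimately show "\<exists>y. y \<noteq> 0 \<and> cmod y < 1 \<and>
       det (pencil (G h) L R y (1 - y) (complex_of_real h * y)) = 0"
      unfolding F_def by blast
  qed
qed

text \<open>A compactness argument. Zeros \<open>y\<close> in the closed disk for \<open>h \<rightarrow> 0\<close> have a limit point after the
coefficient pair is normalised to length one. Its \<open>b\<close>-component is nonzero by the assumption on the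
fast limit; hence \<open>y \<rightarrow> 1\<close>, the ratio \<open>s = a / b\<close> converges to a zero of the slow limit, and
\<open>\<bar>1 + h s\<bar> = 1 / \<bar>y\<bar> \<ge> 1\<close> forces \<open>Re s \<ge> 0\<close> in the limit.\<close>
lemma pencil_no_zero:
  assumes G: "\<And>h. G h \<in> carrier_mat N N" and L: "L \<in> carrier_mat N N" and R: "R \<in> carrier_mat N N"
    and contG: "\<And>i j. i < N \<Longrightarrow> j < N \<Longrightarrow> continuous_on UNIV (\<lambda>h::real. G h $$ (i, j))"
    and fast: "\<And>y. cmod y \<le> 1 \<Longrightarrow> det (pencil (G 0) L R y 1 0) \<noteq> 0"
    and slow: "\<And>s. det (pencil (G 0) L R 1 s 1) = 0 \<Longrightarrow> Re s < 0"
  shows "\<exists>h0>0. \<forall>h\<in>{0<..<h0}. \<forall>y. y \<noteq> 0 \<and> cmod y \<le> 1 \<longrightarrow>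
    det (pencil (G h) L R y (1 - y) (complex_of_real h * y)) \<noteq> 0"
proof (rule ccontr)
  assume contra: "\<not> ?thesis"
  define D where "D h y = det (pencil (G h) L R y (1 - y) (complex_of_real h * y))" for h y
  have "\<exists>h y. h \<in> {0<..<inverse (real (Suc k))} \<and> y \<noteq> 0 \<and> cmod y \<le> 1 \<and> D h y = 0" for k
  proof -
    have "inverse (real (Suc k)) > 0" by simp
    with contra show ?thesis unfolding D_def by blast
  qed
  then obtain H Y where H: "\<And>k. H k \<in> {0<..<inverse (real (Suc k))}"
    and Y: "\<And>k. Y k \<noteq> 0" "\<And>k. cmod (Y k) \<le> 1"
    and det0: "\<And>k. D (H k) (Y k) = 0"
    by metis
  have H0: "H \<longlonglongrightarrow> 0"
    by (rule tendsto_sandwich[OF _ _ tendsto_const LIMSEQ_inverse_real_of_nat])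
      (use H in \<open>auto intro!: always_eventually less_imp_le\<close>)
  define c where "c k = cmod (1 - Y k) + cmod (complex_of_real (H k) * Y k)" for k
  have c: "c k > 0" for k
    using H[of k] Y(1)[of k] by (auto simp: c_def intro!: add_nonneg_pos)
  define a where "a k = (1 - Y k) / complex_of_real (c k)" for k
  define b where "b k = complex_of_real (H k) * Y k / complex_of_real (c k)" for k
  have b0: "b k \<noteq> 0" for k using H[of k] Y(1)[of k] c[of k] by (auto simp: b_def)
  have ab: "cmod (a k) + cmod (b k) = 1" for k
  proof -
    have "cmod (a k) = cmod (1 - Y k) / c k"
      "cmod (b k) = cmod (complex_of_real (H k) * Y k) / c k"
      using c[of k] unfolding a_def b_def norm_divide by simp_all
    then have "cmod (a k) + cmod (b k) = c k / c k"
      unfolding c_def[of k] by (simp only: add_divide_distrib)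
    then show ?thesis using c[of k] by simp
  qed
  have det_ab: "det (pencil (G (H k)) L R (Y k) (a k) (b k)) = 0" for k
    using det_pencil_scale[OF G L R, of "H k" "Y k" "inverse (complex_of_real (c k))"
        "1 - Y k" "complex_of_real (H k) * Y k"] det0[of k, unfolded D_def]
    by (simp add: a_def b_def divide_inverse mult.commute)
  have "(Y k, a k, b k) \<in> cball 0 1 \<times> cball 0 1 \<times> cball 0 1" for k
    using ab[of k] Y(2)[of k] norm_ge_zero[of "a k"] norm_ge_zero[of "b k"]
    by (simp add: del: norm_ge_zero)
  moreover have "compact (cball 0 1 \<times> cball 0 1 \<times> cball 0 1 :: (complex \<times> complex \<times> complex) set)"
    by (intro compact_Times compact_cball)
  ultimately obtain l r where r: "strict_mono (r :: nat \<Rightarrow> nat)"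
    and l: "((\<lambda>k. (Y k, a k, b k)) \<circ> r) \<longlonglongrightarrow> l"
    unfolding compact_def by (metis (no_types, lifting))
  obtain y' a' b' where l_eq: "l = (y', a', b')" by (cases l)
  have limY: "(\<lambda>k. Y (r k)) \<longlonglongrightarrow> y'"
    using tendsto_fst[OF l] by (simp add: o_def l_eq)
  have lima: "(\<lambda>k. a (r k)) \<longlonglongrightarrow> a'"
    using tendsto_fst[OF tendsto_snd[OF l]] by (simp add: o_def l_eq)
  have limb: "(\<lambda>k. b (r k)) \<longlonglongrightarrow> b'"
    using tendsto_snd[OF tendsto_snd[OF l]] by (simp add: o_def l_eq)
  have limH: "(\<lambda>k. H (r k)) \<longlonglongrightarrow> 0"
    using LIMSEQ_subseq_LIMSEQ[OF H0 r] by (simp add: o_def)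
  have "(\<lambda>k. det (pencil (G (H (r k))) L R (Y (r k)) (a (r k)) (b (r k))))
      \<longlonglongrightarrow> det (pencil (G 0) L R y' a' b')"
  proof -
    let ?D = "\<lambda>(h, y, a, b). det (pencil (G h) L R y a b)"
    have "continuous_on UNIV ?D"
      unfolding case_prod_unfold
      by (rule continuous_on_det_pencil[OF G L R])
        (auto intro!: continuous_intros continuous_on_compose2[OF contG])
    then have "isCont ?D (0, y', a', b')" by (simp add: continuous_on_eq_continuous_at)
    from isCont_tendsto_compose[OF this tendsto_Pair[OF limH tendsto_Pair[OF limY tendsto_Pair[OF lima limb]]]]
    show ?thesis by simp
  qed
  then have det': "det (pencil (G 0) L R y' a' b') = 0"
    unfolding det_ab by (simp add: LIMSEQ_const_iff)
  have "(\<lambda>k. cmod (a (r k)) + cmod (b (r k))) \<longlonglongrightarrow> cmod a' + cmod b'"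
    by (intro tendsto_intros lima limb)
  then have norm': "cmod a' + cmod b' = 1" unfolding ab by (simp add: LIMSEQ_const_iff)
  have y'1: "cmod y' \<le> 1"
    by (rule LIMSEQ_le_const2[OF tendsto_norm[OF limY]]) (use Y in auto)
  \<comment> \<open>the pair \<open>(a, b)\<close> is proportional to \<open>(1 - y, h y)\<close>; in the limit this leaves \<open>(1 - y') b' = 0\<close>\<close>
  have "(\<lambda>k. a (r k) * (complex_of_real (H (r k)) * Y (r k))) \<longlonglongrightarrow> a' * (complex_of_real 0 * y')"
    by (intro tendsto_intros lima limH limY)
  moreover have "a (r k) * (complex_of_real (H (r k)) * Y (r k)) = (1 - Y (r k)) * b (r k)" for k
    by (simp add: a_def b_def)
  moreover have "(\<lambda>k. (1 - Y (r k)) * b (r k)) \<longlonglongrightarrow> (1 - y') * b'"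
    by (intro tendsto_intros limb limY)
  ultimately have yb: "(1 - y') * b' = 0"
    using LIMSEQ_unique by fastforce
  have b'0: "b' \<noteq> 0"
  proof
    assume "b' = 0"
    with norm' have "a' \<noteq> 0" by auto
    with det_pencil_scale[OF G L R, of 0 y' a' 1 0] det' \<open>b' = 0\<close> fast[OF y'1] show False by simp
  qed
  with yb have "y' = 1" by simp
  define s where "s k = a (r k) / b (r k)" for k
  have lims: "s \<longlonglongrightarrow> a' / b'"
    unfolding s_def by (intro tendsto_intros lima limb b'0)
  have "det (pencil (G 0) L R 1 (a' / b') 1) = 0"
    using det_pencil_scale[OF G L R, of 0 1 b' "a' / b'" 1] det' b'0 \<open>y' = 1\<close> by simp
  then have neg: "Re (a' / b') < 0" by (rule slow)
  have "2 * Re (s k) + H (r k) * (cmod (s k))\<^sup>2 \<ge> 0" for k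
  proof -
    let ?h = "H (r k)" and ?y = "Y (r k)"
    have h: "?h > 0" using H[of "r k"] by simp
    have "1 + complex_of_real ?h * s k = 1 / ?y"
      using h Y(1)[of "r k"] c[of "r k"] by (simp add: s_def a_def b_def field_simps)
    then have "cmod (1 + complex_of_real ?h * s k) \<ge> 1"
      using Y(1)[of "r k"] Y(2)[of "r k"] by (simp add: norm_divide)
    then have "(cmod (1 + complex_of_real ?h * s k))\<^sup>2 \<ge> 1"
      by simp
    also have "(cmod (1 + complex_of_real ?h * s k))\<^sup>2 = 1 + ?h * (2 * Re (s k) + ?h * (cmod (s k))\<^sup>2)"
      unfolding cmod_power2 by (simp add: power2_eq_square algebra_simps)
    finally show ?thesis using h by (simp add: zero_le_mult_iff)
  qed
  moreover have "(\<lambda>k. 2 * Re (s k) + H (r k) * (cmod (s k))\<^sup>2) \<longlonglongrightarrow> 2 * Re (a' / b') + 0 * (cmod (a' / b'))\<^sup>2"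
    by (intro tendsto_intros lims limH)
  ultimately have "2 * Re (a' / b') + 0 * (cmod (a' / b'))\<^sup>2 \<ge> 0"
    by (intro LIMSEQ_le_const) auto
  with neg show False by simp
qed

section \<open>The averaged matrix exponential\<close>

text \<open>The entire function \<open>\<phi>\<^sub>1(x) = (e\<^sup>x - 1) / x\<close> of exponential integrators, evaluated at \<open>h A\<close>. It is
\<open>\<Gamma>\<^sub>h / h\<close> for \<open>h > 0\<close> and, unlike that quotient, is also defined and continuous at \<open>h = 0\<close>.\<close>
definition phi1 :: "real mat \<Rightarrow> real \<Rightarrow> real mat" where
  "phi1 A h = mat (dim_row A) (dim_row A) (\<lambda>(i, j). \<Sum>k. (A ^\<^sub>m k) $$ (i, j) / fact (Suc k) * h ^ k)"

lemma phi1_carrier [simp]: "A \<in> carrier_mat n n \<Longrightarrow> phi1 A h \<in> carrier_mat n n"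
  by (simp add: phi1_def)

lemma smult_pow_mat:
  fixes A :: "'a::comm_semiring_1 mat"
  assumes "A \<in> carrier_mat n n"
  shows "(t \<cdot>\<^sub>m A) ^\<^sub>m k = t ^ k \<cdot>\<^sub>m (A ^\<^sub>m k)"
proof (induction k)
  case (Suc k)
  have "A ^\<^sub>m k \<in> carrier_mat n n" using assms by (rule pow_carrier_mat)
  then show ?case
    using assms by (intro eq_matI) (auto simp: Suc scalar_prod_def sum_distrib_left mult_ac)
qed (use assms in \<open>auto intro!: eq_matI\<close>)

text \<open>Let \<open>c\<close> be the sum of the absolute values of all entries of \<open>A\<close>: multiplying by another factor
\<open>A\<close> enlarges the entries by at most this factor.\<close>

lemma pow_mat_entry_bound:
  fixes A :: "real mat"
  assumes A: "A \<in> carrier_mat n n"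
  obtains c where "\<And>k i j. i < n \<Longrightarrow> j < n \<Longrightarrow> \<bar>(A ^\<^sub>m k) $$ (i, j)\<bar> \<le> c ^ k"
proof -
  define a where "a = (\<Sum>l = 0..<n. \<Sum>j = 0..<n. \<bar>A $$ (l, j)\<bar>)"
  have a: "a \<ge> 0" unfolding a_def by (intro sum_nonneg) auto
  have "\<bar>(A ^\<^sub>m k) $$ (i, j)\<bar> \<le> a ^ k" if "i < n" "j < n" for k i j
    using that
  proof (induction k arbitrary: j)
    case 0
    then show ?case using A by simp
  next
    case (Suc k)
    have Ak: "A ^\<^sub>m k \<in> carrier_mat n n" using A by (rule pow_carrier_mat)
    have "(A ^\<^sub>m Suc k) $$ (i, j) = (\<Sum>l = 0..<n. (A ^\<^sub>m k) $$ (i, l) * A $$ (l, j))"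
      using A Ak Suc.prems by (simp add: scalar_prod_def)
    also have "\<bar>\<dots>\<bar> \<le> (\<Sum>l = 0..<n. \<bar>(A ^\<^sub>m k) $$ (i, l) * A $$ (l, j)\<bar>)"
      by (rule sum_abs)
    also have "\<dots> \<le> (\<Sum>l = 0..<n. a ^ k * (\<Sum>j = 0..<n. \<bar>A $$ (l, j)\<bar>))"
    proof (rule sum_mono)
      fix l assume l: "l \<in> {0..<n}"
      have "\<bar>A $$ (l, j)\<bar> \<le> (\<Sum>j = 0..<n. \<bar>A $$ (l, j)\<bar>)"
        using Suc.prems by (intro member_le_sum) auto
      then show "\<bar>(A ^\<^sub>m k) $$ (i, l) * A $$ (l, j)\<bar> \<le> a ^ k * (\<Sum>j = 0..<n. \<bar>A $$ (l, j)\<bar>)"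
        unfolding abs_mult using Suc.IH[of l] Suc.prems l a by (intro mult_mono) auto
    qed
    also have "\<dots> = a ^ Suc k" unfolding sum_distrib_left[symmetric] a_def[symmetric] by simp
    finally show ?case .
  qed
  then show thesis by (rule that)
qed

lemma summable_mat_exp_entry:
  fixes A :: "real mat"
  assumes A: "A \<in> carrier_mat n n" and ij: "i < n" "j < n"
  shows "summable (\<lambda>k. (A ^\<^sub>m k) $$ (i, j) / fact k * x ^ k)"
    and "summable (\<lambda>k. (A ^\<^sub>m k) $$ (i, j) / fact (Suc k) * x ^ k)"
proof -
  obtain c where c: "\<And>k i j. i < n \<Longrightarrow> j < n \<Longrightarrow> \<bar>(A ^\<^sub>m k) $$ (i, j)\<bar> \<le> c ^ k"
    using pow_mat_entry_bound[OF A] by blast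
  have sum: "summable (\<lambda>k. inverse (fact k) * (c * \<bar>x\<bar>) ^ k)" by (rule summable_exp)
  have le: "\<bar>(A ^\<^sub>m k) $$ (i, j)\<bar> / d * \<bar>x\<bar> ^ k \<le> inverse (fact k) * (c * \<bar>x\<bar>) ^ k"
    if "d \<ge> fact k" for k and d :: real
  proof -
    have d: "d > 0" "inverse d \<le> inverse (fact k)"
      using that by (auto intro: less_le_trans[OF fact_gt_zero] le_imp_inverse_le)
    have "\<bar>(A ^\<^sub>m k) $$ (i, j)\<bar> * inverse d * \<bar>x\<bar> ^ k \<le> c ^ k * inverse (fact k) * \<bar>x\<bar> ^ k"
      using c[OF ij, of k] d by (intro mult_mono mult_nonneg_nonneg) (auto intro: order_trans[OF abs_ge_zero])
    then show ?thesis by (simp add: divide_inverse power_mult_distrib mult_ac)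
  qed
  show "summable (\<lambda>k. (A ^\<^sub>m k) $$ (i, j) / fact k * x ^ k)"
    by (rule summable_comparison_test'[OF sum, of 0])
      (use le[of _ "fact _"] in \<open>simp add: abs_mult power_abs\<close>)
  show "summable (\<lambda>k. (A ^\<^sub>m k) $$ (i, j) / fact (Suc k) * x ^ k)"
    by (rule summable_comparison_test'[OF sum, of 0])
      (use le[OF fact_mono[OF le_SucI[OF order_refl]]] in \<open>simp add: abs_mult power_abs del: fact_Suc\<close>)
qed

lemma mat_exp_smult_entry:
  assumes A: "A \<in> carrier_mat n n" and ij: "i < n" "j < n"
  shows "mat_exp (t \<cdot>\<^sub>m A) $$ (i, j) = (\<Sum>k. (A ^\<^sub>m k) $$ (i, j) / fact k * t ^ k)"
proof -
  have "A ^\<^sub>m k \<in> carrier_mat n n" for k using A by (rule pow_carrier_mat)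
  then show ?thesis
    using A ij by (simp add: mat_exp_def smult_pow_mat mult.commute)
qed

lemma continuous_on_phi1_entry:
  assumes "A \<in> carrier_mat n n" "i < n" "j < n"
  shows "continuous_on UNIV (\<lambda>h. phi1 A h $$ (i, j))"
  using isCont_powser_converges_everywhere[OF summable_mat_exp_entry(2)[OF assms]] assms
  by (simp add: phi1_def continuous_on_eq_continuous_at)

lemma phi1_0:
  assumes "A \<in> carrier_mat n n"
  shows "phi1 A 0 = 1\<^sub>m n"
  using assms powser_zero[of "\<lambda>k. (A ^\<^sub>m k) $$ (i, j) / fact (Suc k)" for i j]
  by (intro eq_matI) (auto simp: phi1_def simp del: fact_Suc powser_zero)

text \<open>Termwise integration of the exponential series, done backwards: the power series with coefficients
\<open>c\<close> is an antiderivative of the exponential because \<open>diffs c\<close> are the coefficients of the latter.\<close>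
lemma Gamma_eq_smult_phi1:
  assumes A: "A \<in> carrier_mat n n" and h: "h \<ge> 0"
  shows "Gamma A h = h \<cdot>\<^sub>m phi1 A h"
proof (rule eq_matI)
  fix i j assume "i < dim_row (h \<cdot>\<^sub>m phi1 A h)" "j < dim_col (h \<cdot>\<^sub>m phi1 A h)"
  then have ij: "i < n" "j < n" using A by (auto simp: phi1_def)
  define a where "a k = (A ^\<^sub>m k) $$ (i, j)" for k
  define c where "c k = (case k of 0 \<Rightarrow> 0 | Suc l \<Rightarrow> a l / fact (Suc l))" for k
  have shift: "(\<lambda>k. c (Suc k) * x ^ Suc k) = (\<lambda>k. x * (a k / fact (Suc k) * x ^ k))" for x :: real
    by (simp add: c_def fun_eq_iff)
  have sum_phi: "summable (\<lambda>k. a k / fact (Suc k) * x ^ k)" for x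
    using summable_mat_exp_entry(2)[OF A ij] by (simp add: a_def)
  have sum_c: "summable (\<lambda>k. c k * x ^ k)" for x
    using summable_mult[OF sum_phi, of x x] unfolding shift[symmetric] summable_Suc_iff[of "\<lambda>k. c k * x ^ k"] .
  have diffs: "diffs c k = a k / fact k" for k
    by (simp add: diffs_def c_def)
  let ?P = "\<lambda>x. \<Sum>k. c k * x ^ k"
  have "((\<lambda>\<tau>. mat_exp (\<tau> \<cdot>\<^sub>m A) $$ (i, j)) has_integral ?P h - ?P 0) {0..h}"
  proof (rule fundamental_theorem_of_calculus[OF h])
    fix x assume "x \<in> {0..h}"
    have "(?P has_field_derivative mat_exp (x \<cdot>\<^sub>m A) $$ (i, j)) (at x)"
      using termdiffs_strong_converges_everywhere[OF sum_c, of x]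
      by (simp add: mat_exp_smult_entry[OF A ij] diffs a_def)
    then show "(?P has_vector_derivative mat_exp (x \<cdot>\<^sub>m A) $$ (i, j)) (at x within {0..h})"
      by (simp add: has_real_derivative_iff_has_vector_derivative has_vector_derivative_at_within)
  qed
  then have "Gamma A h $$ (i, j) = ?P h - ?P 0"
    using A ij by (simp add: Gamma_def integral_unique)
  also have "?P 0 = 0" by (simp add: c_def powser_zero)
  also have "?P h = h * (\<Sum>k. a k / fact (Suc k) * h ^ k)"
    using suminf_split_head[OF sum_c, of h] suminf_mult[OF sum_phi, of h h]
    unfolding shift by (simp add: c_def)
  finally show "Gamma A h $$ (i, j) = (h \<cdot>\<^sub>m phi1 A h) $$ (i, j)"
    using A ij by (simp add: phi1_def a_def)
qed (use A in \<open>auto simp: Gamma_def phi1_def\<close>)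

text \<open>The matrix form of \<open>e\<^sup>x = 1 + x \<phi>\<^sub>1(x)\<close>: the exponential series without its first term, with one
factor \<open>h A\<close> pulled out.\<close>
lemma Phi_eq_phi1:
  assumes A: "A \<in> carrier_mat n n"
  shows "Phi A h = 1\<^sub>m n + h \<cdot>\<^sub>m (phi1 A h * A)"
proof (rule eq_matI)
  fix i j assume "i < dim_row (1\<^sub>m n + h \<cdot>\<^sub>m (phi1 A h * A))" "j < dim_col (1\<^sub>m n + h \<cdot>\<^sub>m (phi1 A h * A))"
  then have ij: "i < n" "j < n" using A by (auto simp: phi1_def)
  let ?t = "\<lambda>k l. (A ^\<^sub>m k) $$ (i, l) / fact (Suc k) * h ^ k"
  have step: "(A ^\<^sub>m Suc k) $$ (i, j) / fact (Suc k) * h ^ Suc k = h * (\<Sum>l = 0..<n. ?t k l * A $$ (l, j))" for k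
  proof -
    have "A ^\<^sub>m k \<in> carrier_mat n n" using A by (rule pow_carrier_mat)
    then have "(A ^\<^sub>m Suc k) $$ (i, j) = (\<Sum>l = 0..<n. (A ^\<^sub>m k) $$ (i, l) * A $$ (l, j))"
      using A ij by (simp add: scalar_prod_def)
    then show ?thesis by (simp add: sum_distrib_left sum_distrib_right sum_divide_distrib mult_ac del: fact_Suc)
  qed
  have summ: "summable (\<lambda>k. ?t k l * A $$ (l, j))" if "l < n" for l
    by (rule summable_mult2[OF summable_mat_exp_entry(2)[OF A ij(1) that]])
  have "Phi A h $$ (i, j) = (1\<^sub>m n) $$ (i, j) + (\<Sum>k. (A ^\<^sub>m Suc k) $$ (i, j) / fact (Suc k) * h ^ Suc k)"
    using suminf_split_head[OF summable_mat_exp_entry(1)[OF A ij], of h] A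
    by (simp add: Phi_def mat_exp_smult_entry[OF A ij])
  also have "(\<Sum>k. (A ^\<^sub>m Suc k) $$ (i, j) / fact (Suc k) * h ^ Suc k)
      = h * (\<Sum>k. \<Sum>l = 0..<n. ?t k l * A $$ (l, j))"
    unfolding step by (rule suminf_mult) (intro summable_sum summ, simp)
  also have "(\<Sum>k. \<Sum>l = 0..<n. ?t k l * A $$ (l, j)) = (\<Sum>l = 0..<n. \<Sum>k. ?t k l * A $$ (l, j))"
    by (rule suminf_sum) (rule summ, simp)
  also have "\<dots> = (\<Sum>l = 0..<n. (\<Sum>k. ?t k l) * A $$ (l, j))"
    by (intro sum.cong refl suminf_mult2[symmetric] summable_mat_exp_entry(2)[OF A]) (use ij in auto)
  also have "\<dots> = (phi1 A h * A) $$ (i, j)"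
    using A ij by (simp add: phi1_def scalar_prod_def)
  finally show "Phi A h $$ (i, j) = (1\<^sub>m n + h \<cdot>\<^sub>m (phi1 A h * A)) $$ (i, j)"
    using A ij by (simp add: phi1_def)
qed (use A in \<open>auto simp: Phi_def mat_exp_def phi1_def\<close>)

section \<open>The lifted matrix without negative powers of the sampling period\<close>

text \<open>The shape of the lifted matrix for \<open>g = \<Gamma>\<^sub>h / h\<close>, \<open>D = B K\<^sub>D\<close>, \<open>P = A - B K\<^sub>P C\<close> and \<open>I = B K\<^sub>I\<close>. It is stated over
an arbitrary field so that the same expression serves for the real matrix and its complexification.\<close>
definition lift_blocks ::
  "'a::field mat \<Rightarrow> 'a mat \<Rightarrow> 'a mat \<Rightarrow> 'a mat \<Rightarrow> 'a mat \<Rightarrow> 'a \<Rightarrow> 'a mat" where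
  "lift_blocks g D P I C h = (let n = dim_row g; p = dim_row C in
     four_block_mat
       (four_block_mat (1\<^sub>m n + h \<cdot>\<^sub>m (g * P) - g * D * C) (- (h \<cdot>\<^sub>m (g * I))) (h \<cdot>\<^sub>m C) (1\<^sub>m p))
       (g * D @\<^sub>r 0\<^sub>m p p)
       (four_block_mat C (0\<^sub>m p p) (0\<^sub>m 0 n) (0\<^sub>m 0 p))
       (0\<^sub>m p p))"

text \<open>In the top left corner, \<open>h G A\<close> from \<open>\<Phi>\<^sub>h\<close> and the proportional feedback \<open>- h G B K\<^sub>P C\<close> combine to
\<open>h G P\<close>, while the factor \<open>1 / h\<close> of the derivative action cancels against \<open>\<Gamma>\<^sub>h = h G\<close>.\<close>
lemma A_lift_eq_lift_blocks:
  assumes A: "A \<in> carrier_mat n n" and B: "B \<in> carrier_mat n m" and C: "C \<in> carrier_mat p n"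
    and KP: "KP \<in> carrier_mat m p" and KI: "KI \<in> carrier_mat m p" and KD: "KD \<in> carrier_mat m p"
    and h: "h > 0"
  shows "A_lift A B C KP KI KD h = lift_blocks (phi1 A h) (B * KD) (A - B * KP * C) (B * KI) C h"
proof -
  define g where "g = phi1 A h"
  have g: "g \<in> carrier_mat n n" using A by (simp add: g_def)
  have BX: "(h \<cdot>\<^sub>m g) * B * X = h \<cdot>\<^sub>m (g * (B * X))" if "X \<in> carrier_mat m p" for X
    using that g B
    by (simp add: mult_smult_assoc_mat[of g n n B] mult_smult_assoc_mat[of "g * B" n m X p]
        assoc_mult_mat[of g n n B m X p])
  have smult_BX: "inverse h \<cdot>\<^sub>m ((h \<cdot>\<^sub>m g) * B * KD) = g * (B * KD)"
    unfolding BX[OF KD] using g B KD h by (intro eq_matI) auto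
  have "(h \<cdot>\<^sub>m g) * B * (KP + inverse h \<cdot>\<^sub>m KD) * C = h \<cdot>\<^sub>m (g * (B * KP * C)) + g * (B * KD) * C"
  proof -
    have "(h \<cdot>\<^sub>m g) * B * (KP + inverse h \<cdot>\<^sub>m KD) = h \<cdot>\<^sub>m (g * (B * KP)) + g * (B * KD)"
    proof -
      have "(h \<cdot>\<^sub>m g) * B * (KP + inverse h \<cdot>\<^sub>m KD)
          = (h \<cdot>\<^sub>m g) * B * KP + (h \<cdot>\<^sub>m g) * B * (inverse h \<cdot>\<^sub>m KD)"
        using g B KP KD by (intro mult_add_distrib_mat) auto
      also have "(h \<cdot>\<^sub>m g) * B * (inverse h \<cdot>\<^sub>m KD) = inverse h \<cdot>\<^sub>m ((h \<cdot>\<^sub>m g) * B * KD)"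
        using g B KD by (intro mult_smult_distrib[of _ n m]) auto
      finally show ?thesis unfolding smult_BX BX[OF KP] .
    qed
    also have "(h \<cdot>\<^sub>m (g * (B * KP)) + g * (B * KD)) * C = h \<cdot>\<^sub>m (g * (B * KP)) * C + g * (B * KD) * C"
      using g B KP KD C by (intro add_mult_distrib_mat) auto
    also have "h \<cdot>\<^sub>m (g * (B * KP)) * C = h \<cdot>\<^sub>m (g * (B * KP * C))"
      using g B KP C by (simp add: mult_smult_assoc_mat[of _ n p] assoc_mult_mat[of g n n "B * KP" p C n])
    finally show ?thesis .
  qed
  moreover have "g * (A - B * KP * C) = g * A - g * (B * KP * C)"
    using g A B KP C by (intro mult_minus_distrib_mat) auto
  ultimately have corner: "Phi A h - (h \<cdot>\<^sub>m g) * B * (KP + inverse h \<cdot>\<^sub>m KD) * C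
      = 1\<^sub>m n + h \<cdot>\<^sub>m (g * (A - B * KP * C)) - g * (B * KD) * C"
    unfolding Phi_eq_phi1[OF A] g_def[symmetric]
    using g A B KP KD C by (intro eq_matI) (auto simp: algebra_simps)
  show ?thesis
    unfolding A_lift_def lift_blocks_def Gamma_eq_smult_phi1[OF A less_imp_le[OF h]] g_def[symmetric]
      Let_def corner BX[OF KI] smult_BX
    using A g C by simp
qed

lemma cmat_lift_blocks:
  assumes g: "g \<in> carrier_mat n n" and D: "D \<in> carrier_mat n p" and P: "P \<in> carrier_mat n n"
    and I: "I \<in> carrier_mat n p" and C: "C \<in> carrier_mat p n"
  shows "cmat (lift_blocks g D P I C h) =
    lift_blocks (cmat g) (cmat D) (cmat P) (cmat I) (cmat C) (complex_of_real h)"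
proof -
  have mult: "cmat (g * P) = cmat g * cmat P" "cmat (g * D * C) = cmat g * cmat D * cmat C"
    "cmat (g * D) = cmat g * cmat D" "cmat (g * I) = cmat g * cmat I"
    using g D P I C
    by (simp_all add: of_real_hom.mat_hom_mult[of _ n n] of_real_hom.mat_hom_mult[of _ n p]
        del: assoc_mult_mat)
  have gPDI: "g * P \<in> carrier_mat n n" "g * D * C \<in> carrier_mat n n" "g * D \<in> carrier_mat n p" "g * I \<in> carrier_mat n p"
    using g D P I C by auto
  have corner: "cmat (1\<^sub>m n + h \<cdot>\<^sub>m X - Y) = 1\<^sub>m n + complex_of_real h \<cdot>\<^sub>m cmat X - cmat Y"
    if "X \<in> carrier_mat n n" "Y \<in> carrier_mat n n" for X Y
    using that by (intro eq_matI) auto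
  have smult: "cmat (h \<cdot>\<^sub>m X) = complex_of_real h \<cdot>\<^sub>m cmat X" "cmat (- X) = - cmat X"
    "cmat (0\<^sub>m r c) = 0\<^sub>m r c" "cmat (1\<^sub>m r) = 1\<^sub>m r" for X r c
    by (intro eq_matI; auto)+
  let ?A11 = "1\<^sub>m n + h \<cdot>\<^sub>m (g * P) - g * D * C" and ?A12 = "- (h \<cdot>\<^sub>m (g * I))"
  let ?A = "four_block_mat ?A11 ?A12 (h \<cdot>\<^sub>m C) (1\<^sub>m p)" and ?B = "g * D @\<^sub>r 0\<^sub>m p p"
    and ?C = "four_block_mat C (0\<^sub>m p p) (0\<^sub>m 0 n) (0\<^sub>m 0 p)"
  have A11: "?A11 \<in> carrier_mat n n" by (rule minus_carrier_mat[OF gPDI(2)])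
  have A12: "?A12 \<in> carrier_mat n p" using gPDI(4) by simp
  have A: "?A \<in> carrier_mat (n + p) (n + p)"
    by (rule four_block_carrier_mat[OF A11 one_carrier_mat])
  have B: "?B \<in> carrier_mat (n + p) p"
    by (rule carrier_append_rows[OF gPDI(3) zero_carrier_mat])
  have C': "?C \<in> carrier_mat p (n + p)"
    using four_block_carrier_mat[OF C, of "0\<^sub>m 0 p" 0 p] by simp
  have "cmat ?A = four_block_mat (1\<^sub>m n + complex_of_real h \<cdot>\<^sub>m (cmat g * cmat P) - cmat g * cmat D * cmat C)
      (- (complex_of_real h \<cdot>\<^sub>m (cmat g * cmat I))) (complex_of_real h \<cdot>\<^sub>m cmat C) (1\<^sub>m p)"
    unfolding map_four_block_mat[OF A11 A12 smult_carrier_mat[OF C] one_carrier_mat]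
      corner[OF gPDI(1,2)] smult mult ..
  moreover have "cmat ?B = cmat g * cmat D @\<^sub>r 0\<^sub>m p p"
  proof -
    have dims: "dim_row (g * D) = n" "dim_row (cmat g * cmat D) = n"
      using carrier_matD(1)[OF g] by simp_all
    show ?thesis
      unfolding append_rows_def index_zero_mat dims
        map_four_block_mat[OF gPDI(3) zero_carrier_mat zero_carrier_mat zero_carrier_mat] smult mult ..
  qed
  moreover have "cmat ?C = four_block_mat (cmat C) (0\<^sub>m p p) (0\<^sub>m 0 n) (0\<^sub>m 0 p)"
    unfolding map_four_block_mat[OF C zero_carrier_mat zero_carrier_mat zero_carrier_mat] smult ..
  moreover have "cmat (four_block_mat ?A ?B ?C (0\<^sub>m p p)) = four_block_mat (cmat ?A) (cmat ?B) (cmat ?C) (0\<^sub>m p p)"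
    unfolding map_four_block_mat[OF A B C' zero_carrier_mat] smult ..
  moreover have "dim_row g = n" "dim_row C = p" "dim_row (cmat g) = n" "dim_row (cmat C) = p"
    using carrier_matD(1)[OF g] carrier_matD(1)[OF C] by simp_all
  ultimately show ?thesis
    unfolding lift_blocks_def Let_def by (simp only:)
qed

section \<open>Eigenvalues of the lifted matrix as zeros of the pencil\<close>

text \<open>The sampled input acts on the plant state only, so the averaged exponential is extended by the
identity on the integrator states.\<close>
definition hold_block :: "complex mat \<Rightarrow> nat \<Rightarrow> complex mat" where
  "hold_block g p = four_block_mat g (0\<^sub>m (dim_row g) p) (0\<^sub>m p (dim_row g)) (1\<^sub>m p)"

text \<open>The matrices \<open>L\<close> (derivative action, here) and \<open>R\<close> (everything else, below) of the reduced eigenvalue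
equation, acting on plant and integrator states.\<close>
definition deriv_block :: "complex mat \<Rightarrow> complex mat \<Rightarrow> complex mat" where
  "deriv_block D C = four_block_mat (D * C) (0\<^sub>m (dim_row D) (dim_row C)) (0\<^sub>m (dim_row C) (dim_row D))
     (0\<^sub>m (dim_row C) (dim_row C))"

definition pi_block :: "complex mat \<Rightarrow> complex mat \<Rightarrow> complex mat \<Rightarrow> complex mat" where
  "pi_block P I C = four_block_mat P (- I) C (0\<^sub>m (dim_row C) (dim_row C))"

lemma zero_mat_mult_vec: "u \<in> carrier_vec c \<Longrightarrow> 0\<^sub>m r c *\<^sub>v u = 0\<^sub>v r"
  by (intro eq_vecI) (auto simp: scalar_prod_def)

lemma smult_mat_mult_vec:
  fixes A :: "'a::comm_ring_1 mat"
  shows "A \<in> carrier_mat r c \<Longrightarrow> u \<in> carrier_vec c \<Longrightarrow> (k \<cdot>\<^sub>m A) *\<^sub>v u = k \<cdot>\<^sub>v (A *\<^sub>v u)"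
  by (intro eq_vecI) (auto simp: scalar_prod_def sum_distrib_left mult_ac)

lemma hold_block_carrier [simp]: "g \<in> carrier_mat n n \<Longrightarrow> hold_block g p \<in> carrier_mat (n + p) (n + p)"
  by (simp add: hold_block_def)

lemma hold_block_one: "hold_block (1\<^sub>m n) p = 1\<^sub>m (n + p)"
  by (intro eq_matI) (auto simp: hold_block_def)

lemma deriv_block_carrier [simp]:
  "D \<in> carrier_mat n p \<Longrightarrow> C \<in> carrier_mat p n \<Longrightarrow> deriv_block D C \<in> carrier_mat (n + p) (n + p)"
  by (simp add: deriv_block_def)

lemma pi_block_carrier [simp]:
  "P \<in> carrier_mat n n \<Longrightarrow> C \<in> carrier_mat p n \<Longrightarrow> pi_block P I C \<in> carrier_mat (n + p) (n + p)"
  by (simp add: pi_block_def)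

lemma pencil_mult_append:
  assumes g: "g \<in> carrier_mat n n" and D: "D \<in> carrier_mat n p" and P: "P \<in> carrier_mat n n"
    and I: "I \<in> carrier_mat n p" and C: "C \<in> carrier_mat p n"
    and x: "x \<in> carrier_vec n" and u: "u \<in> carrier_vec p"
  shows "pencil (hold_block g p) (deriv_block D C) (pi_block P I C) y a b *\<^sub>v (x @\<^sub>v u) =
    (a \<cdot>\<^sub>v x + ((a * y) \<cdot>\<^sub>v ((g * D) *\<^sub>v (C *\<^sub>v x)) - b \<cdot>\<^sub>v ((g * P) *\<^sub>v x) + b \<cdot>\<^sub>v ((g * I) *\<^sub>v u)))
      @\<^sub>v (a \<cdot>\<^sub>v u - b \<cdot>\<^sub>v (C *\<^sub>v x))"
proof -
  let ?G = "hold_block g p" and ?L = "deriv_block D C" and ?R = "pi_block P I C" and ?v = "x @\<^sub>v u"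
  have v: "?v \<in> carrier_vec (n + p)" using x u by simp
  have Cx: "C *\<^sub>v x \<in> carrier_vec p" using C x by simp
  have L: "?L \<in> carrier_mat (n + p) (n + p)" and R: "?R \<in> carrier_mat (n + p) (n + p)"
    and G: "?G \<in> carrier_mat (n + p) (n + p)" using D C P g by auto
  have Lv: "?L *\<^sub>v ?v = (D *\<^sub>v (C *\<^sub>v x)) @\<^sub>v 0\<^sub>v p"
  proof -
    have "?L *\<^sub>v ?v = ((D * C) *\<^sub>v x + 0\<^sub>m n p *\<^sub>v u) @\<^sub>v (0\<^sub>m p n *\<^sub>v x + 0\<^sub>m p p *\<^sub>v u)"
      using D C x u unfolding deriv_block_def
      by (subst four_block_mat_mult_vec[of _ n n _ p _ p]) auto
    also have "(D * C) *\<^sub>v x = D *\<^sub>v (C *\<^sub>v x)"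
      using D C x by (rule assoc_mult_mat_vec)
    finally show ?thesis using D C x u by (simp add: zero_mat_mult_vec)
  qed
  have Rv: "?R *\<^sub>v ?v = (P *\<^sub>v x - I *\<^sub>v u) @\<^sub>v (C *\<^sub>v x)"
  proof -
    have "?R *\<^sub>v ?v = (P *\<^sub>v x + (- I) *\<^sub>v u) @\<^sub>v (C *\<^sub>v x + 0\<^sub>m p p *\<^sub>v u)"
      using P I C x u unfolding pi_block_def
      by (subst four_block_mat_mult_vec[of _ n n _ p _ p]) auto
    also have "P *\<^sub>v x + (- I) *\<^sub>v u = P *\<^sub>v x - I *\<^sub>v u"
      using P I x u by (intro eq_vecI) (auto simp: scalar_prod_def sum_negf)
    finally show ?thesis using C x u by (simp add: zero_mat_mult_vec)
  qed
  define q where "q = (a * y) \<cdot>\<^sub>v (D *\<^sub>v (C *\<^sub>v x)) - b \<cdot>\<^sub>v (P *\<^sub>v x) + b \<cdot>\<^sub>v (I *\<^sub>v u)"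
  have q: "q \<in> carrier_vec n" using P D I C x u by (auto simp: q_def)
  have "((a * y) \<cdot>\<^sub>m ?L - b \<cdot>\<^sub>m ?R) *\<^sub>v ?v = (a * y) \<cdot>\<^sub>v (?L *\<^sub>v ?v) - b \<cdot>\<^sub>v (?R *\<^sub>v ?v)"
    using L R v by (simp add: minus_mult_distrib_mat_vec[of _ "n + p" "n + p"] smult_mat_mult_vec)
  also have "\<dots> = q @\<^sub>v (- (b \<cdot>\<^sub>v (C *\<^sub>v x)))"
    unfolding Lv Rv q_def using P D I C x u
    by (intro eq_vecI) (auto simp: algebra_simps)
  finally have inner: "((a * y) \<cdot>\<^sub>m ?L - b \<cdot>\<^sub>m ?R) *\<^sub>v ?v = q @\<^sub>v (- (b \<cdot>\<^sub>v (C *\<^sub>v x)))" .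
  have "(?G * ((a * y) \<cdot>\<^sub>m ?L - b \<cdot>\<^sub>m ?R)) *\<^sub>v ?v = ?G *\<^sub>v (q @\<^sub>v (- (b \<cdot>\<^sub>v (C *\<^sub>v x))))"
    unfolding inner[symmetric] using G L R v by (intro assoc_mult_mat_vec) auto
  also have "\<dots> = (g *\<^sub>v q + 0\<^sub>m n p *\<^sub>v (- (b \<cdot>\<^sub>v (C *\<^sub>v x)))) @\<^sub>v (0\<^sub>m p n *\<^sub>v q + 1\<^sub>m p *\<^sub>v (- (b \<cdot>\<^sub>v (C *\<^sub>v x))))"
    using g q Cx unfolding hold_block_def
    by (subst four_block_mat_mult_vec[of _ n n _ p _ p]) auto
  also have "\<dots> = (g *\<^sub>v q) @\<^sub>v (- (b \<cdot>\<^sub>v (C *\<^sub>v x)))"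
    using g q Cx by (simp add: zero_mat_mult_vec)
  also have "g *\<^sub>v q = (a * y) \<cdot>\<^sub>v ((g * D) *\<^sub>v (C *\<^sub>v x)) - b \<cdot>\<^sub>v ((g * P) *\<^sub>v x) + b \<cdot>\<^sub>v ((g * I) *\<^sub>v u)"
    using g P D I C x u Cx unfolding q_def
    by (simp add: mult_add_distrib_mat_vec[of _ n n] mult_minus_distrib_mat_vec[of _ n n]
        mult_mat_vec[of _ n n] assoc_mult_mat_vec[of _ n n])
  finally have GLR: "(?G * ((a * y) \<cdot>\<^sub>m ?L - b \<cdot>\<^sub>m ?R)) *\<^sub>v ?v = \<dots> @\<^sub>v (- (b \<cdot>\<^sub>v (C *\<^sub>v x)))" .
  have "pencil ?G ?L ?R y a b *\<^sub>v ?v = a \<cdot>\<^sub>v ?v + (?G * ((a * y) \<cdot>\<^sub>m ?L - b \<cdot>\<^sub>m ?R)) *\<^sub>v ?v"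
  proof -
    have "(a \<cdot>\<^sub>m 1\<^sub>m (n + p) + ?G * ((a * y) \<cdot>\<^sub>m ?L - b \<cdot>\<^sub>m ?R)) *\<^sub>v ?v
        = (a \<cdot>\<^sub>m 1\<^sub>m (n + p)) *\<^sub>v ?v + (?G * ((a * y) \<cdot>\<^sub>m ?L - b \<cdot>\<^sub>m ?R)) *\<^sub>v ?v"
      using G L R v by (intro add_mult_distrib_mat_vec) auto
    also have "(a \<cdot>\<^sub>m 1\<^sub>m (n + p)) *\<^sub>v ?v = a \<cdot>\<^sub>v ?v"
      using v by (simp add: smult_mat_mult_vec[of _ "n + p" "n + p"])
    finally show ?thesis using G by (simp add: pencil_def)
  qed
  then show ?thesis
    unfolding GLR using x u g P D I C by (intro eq_vecI) auto
qed

lemma append_vec_eq_zero_iff: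
  assumes "a \<in> carrier_vec n" "b \<in> carrier_vec p"
  shows "a @\<^sub>v b = 0\<^sub>v (n + p) \<longleftrightarrow> a = 0\<^sub>v n \<and> b = 0\<^sub>v p"
proof -
  have "0\<^sub>v (n + p) = 0\<^sub>v n @\<^sub>v 0\<^sub>v p" by (intro eq_vecI) auto
  then show ?thesis using append_vec_eq[OF assms(1) zero_carrier_vec] by metis
qed

text \<open>The last block row of the eigenvalue equation determines \<open>w = y C x\<close>. Substituting this and
multiplying the other rows by \<open>y\<close> turns them into the kernel equation of the pencil, so eigenvectors
\<open>(x, u, w)\<close> and kernel vectors \<open>(x, u)\<close> correspond to each other; \<open>x = 0\<close>, \<open>u = 0\<close> would force \<open>w = 0\<close>.\<close>
lemma eigenvalue_lift_blocks_iff: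
  assumes g: "g \<in> carrier_mat n n" and D: "D \<in> carrier_mat n p" and P: "P \<in> carrier_mat n n"
    and I: "I \<in> carrier_mat n p" and C: "C \<in> carrier_mat p n"
    and y: "y \<noteq> 0"
  shows "eigenvalue (lift_blocks g D P I C h) (1 / y) \<longleftrightarrow>
    det (pencil (hold_block g p) (deriv_block D C) (pi_block P I C) y (1 - y) (h * y)) = 0"
proof -
  let ?M = "lift_blocks g D P I C h"
  let ?T = "pencil (hold_block g p) (deriv_block D C) (pi_block P I C) y (1 - y) (h * y)"
  let ?k1 = "\<lambda>x. (g * D) *\<^sub>v (C *\<^sub>v x)" and ?k2 = "\<lambda>x. (g * P) *\<^sub>v x" and ?k3 = "\<lambda>u. (g * I) *\<^sub>v u"
  have M: "?M \<in> carrier_mat (n + p + p) (n + p + p)"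
    using g C by (intro carrier_matI) (simp_all add: lift_blocks_def Let_def)
  have T: "?T \<in> carrier_mat (n + p) (n + p)"
    by (rule pencil_carrier) (use g D P C in auto)
  have k: "?k1 x \<in> carrier_vec n" "?k2 x \<in> carrier_vec n" "?k3 u \<in> carrier_vec n" "C *\<^sub>v x \<in> carrier_vec p"
    if "x \<in> carrier_vec n" "u \<in> carrier_vec p" for x u
    using g D P I C that by auto
  have Mv: "?M *\<^sub>v ((x @\<^sub>v u) @\<^sub>v w) =
      ((x + h \<cdot>\<^sub>v ?k2 x - ?k1 x - h \<cdot>\<^sub>v ?k3 u + (g * D) *\<^sub>v w) @\<^sub>v (h \<cdot>\<^sub>v (C *\<^sub>v x) + u)) @\<^sub>v (C *\<^sub>v x)"
    if x: "x \<in> carrier_vec n" and u: "u \<in> carrier_vec p" and w: "w \<in> carrier_vec p" for x u w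
  proof -
    let ?A11 = "1\<^sub>m n + h \<cdot>\<^sub>m (g * P) - g * D * C" and ?A12 = "- (h \<cdot>\<^sub>m (g * I))"
    let ?A = "four_block_mat ?A11 ?A12 (h \<cdot>\<^sub>m C) (1\<^sub>m p)" and ?B = "g * D @\<^sub>r 0\<^sub>m p p"
      and ?C = "four_block_mat C (0\<^sub>m p p) (0\<^sub>m 0 n) (0\<^sub>m 0 p)"
    have A11: "?A11 \<in> carrier_mat n n"
      by (rule minus_carrier_mat[OF mult_carrier_mat[OF mult_carrier_mat[OF g D] C]])
    have A12: "?A12 \<in> carrier_mat n p"
      using mult_carrier_mat[OF g I] by simp
    have A: "?A \<in> carrier_mat (n + p) (n + p)"
      by (rule four_block_carrier_mat[OF A11 one_carrier_mat])
    have B: "?B \<in> carrier_mat (n + p) p"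
      by (rule carrier_append_rows[OF mult_carrier_mat[OF g D] zero_carrier_mat])
    have C': "?C \<in> carrier_mat p (n + p)"
      using four_block_carrier_mat[OF C, of "0\<^sub>m 0 p" 0 p] by simp
    have "?M = four_block_mat ?A ?B ?C (0\<^sub>m p p)"
      using g C by (simp add: lift_blocks_def Let_def)
    also have "\<dots> *\<^sub>v ((x @\<^sub>v u) @\<^sub>v w) = (?A *\<^sub>v (x @\<^sub>v u) + ?B *\<^sub>v w) @\<^sub>v (?C *\<^sub>v (x @\<^sub>v u) + 0\<^sub>m p p *\<^sub>v w)"
      using A B C' x u w by (intro four_block_mat_mult_vec) auto
    also have "?A *\<^sub>v (x @\<^sub>v u) = (?A11 *\<^sub>v x + ?A12 *\<^sub>v u) @\<^sub>v ((h \<cdot>\<^sub>m C) *\<^sub>v x + 1\<^sub>m p *\<^sub>v u)"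
      using A11 A12 C x u by (intro four_block_mat_mult_vec) auto
    also have "?B *\<^sub>v w = ((g * D) *\<^sub>v w) @\<^sub>v (0\<^sub>m p p *\<^sub>v w)"
      using g D w by (intro mat_mult_append) auto
    also have "?C *\<^sub>v (x @\<^sub>v u) = (C *\<^sub>v x + 0\<^sub>m p p *\<^sub>v u) @\<^sub>v (0\<^sub>m 0 n *\<^sub>v x + 0\<^sub>m 0 p *\<^sub>v u)"
      using C x u by (intro four_block_mat_mult_vec) auto
    also have "?A11 *\<^sub>v x = x + h \<cdot>\<^sub>v ?k2 x - ?k1 x"
    proof -
      have "?A11 *\<^sub>v x = (1\<^sub>m n + h \<cdot>\<^sub>m (g * P)) *\<^sub>v x - (g * D * C) *\<^sub>v x"
        using g P D C x by (intro minus_mult_distrib_mat_vec) auto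
      also have "(1\<^sub>m n + h \<cdot>\<^sub>m (g * P)) *\<^sub>v x = 1\<^sub>m n *\<^sub>v x + (h \<cdot>\<^sub>m (g * P)) *\<^sub>v x"
        using g P x by (intro add_mult_distrib_mat_vec) auto
      also have "(h \<cdot>\<^sub>m (g * P)) *\<^sub>v x = h \<cdot>\<^sub>v ?k2 x"
        using g P x by (intro smult_mat_mult_vec) auto
      also have "(g * D * C) *\<^sub>v x = ?k1 x"
        using g D C x by (intro assoc_mult_mat_vec) auto
      finally show ?thesis using x by simp
    qed
    also have "?A12 *\<^sub>v u = - (h \<cdot>\<^sub>v ?k3 u)"
      using g I u smult_mat_mult_vec[of "g * I" n p u h] by simp
    also have "(h \<cdot>\<^sub>m C) *\<^sub>v x = h \<cdot>\<^sub>v (C *\<^sub>v x)"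
      using C x by (rule smult_mat_mult_vec)
    finally show ?thesis
      using x u w g D P I C by (intro eq_vecI) (auto simp: zero_mat_mult_vec)
  qed
  have Tv: "?T *\<^sub>v (x @\<^sub>v u) = 0\<^sub>v (n + p) \<longleftrightarrow>
      (\<forall>i<n. (1 - y) * x $ i + (1 - y) * y * ?k1 x $ i - h * y * ?k2 x $ i + h * y * ?k3 u $ i = 0) \<and>
      (\<forall>i<p. (1 - y) * u $ i - h * y * (C *\<^sub>v x) $ i = 0)"
    if x: "x \<in> carrier_vec n" and u: "u \<in> carrier_vec p" for x u
  proof -
    have "?T *\<^sub>v (x @\<^sub>v u) = 0\<^sub>v (n + p) \<longleftrightarrow>
        (1 - y) \<cdot>\<^sub>v x + (((1 - y) * y) \<cdot>\<^sub>v ?k1 x - (h * y) \<cdot>\<^sub>v ?k2 x + (h * y) \<cdot>\<^sub>v ?k3 u) = 0\<^sub>v n \<and>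
        (1 - y) \<cdot>\<^sub>v u - (h * y) \<cdot>\<^sub>v (C *\<^sub>v x) = 0\<^sub>v p"
      unfolding pencil_mult_append[OF g D P I C x u]
      by (rule append_vec_eq_zero_iff) (use k[OF x u] x u in simp_all)
    then show ?thesis
      using g C x u by (simp add: vec_eq_iff algebra_simps del: index_mult_mat_vec assoc_mult_mat_vec)
  qed
  have Mev: "?M *\<^sub>v ((x @\<^sub>v u) @\<^sub>v w) = (1 / y) \<cdot>\<^sub>v ((x @\<^sub>v u) @\<^sub>v w) \<longleftrightarrow>
      w = y \<cdot>\<^sub>v (C *\<^sub>v x) \<and> ?T *\<^sub>v (x @\<^sub>v u) = 0\<^sub>v (n + p)"
    if x: "x \<in> carrier_vec n" and u: "u \<in> carrier_vec p" and w: "w \<in> carrier_vec p" for x u w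
  proof -
    have kw: "(g * D) *\<^sub>v w \<in> carrier_vec n" using g D w by auto
    have entries: "?M *\<^sub>v ((x @\<^sub>v u) @\<^sub>v w) = (1 / y) \<cdot>\<^sub>v ((x @\<^sub>v u) @\<^sub>v w) \<longleftrightarrow>
      (\<forall>i<n. x $ i + h * ?k2 x $ i - ?k1 x $ i - h * ?k3 u $ i + ((g * D) *\<^sub>v w) $ i = 1 / y * x $ i) \<and>
      (\<forall>i<p. h * (C *\<^sub>v x) $ i + u $ i = 1 / y * u $ i) \<and> (\<forall>i<p. (C *\<^sub>v x) $ i = 1 / y * w $ i)"
    proof -
      have "(1 / y) \<cdot>\<^sub>v ((x @\<^sub>v u) @\<^sub>v w) = (((1 / y) \<cdot>\<^sub>v x) @\<^sub>v ((1 / y) \<cdot>\<^sub>v u)) @\<^sub>v ((1 / y) \<cdot>\<^sub>v w)"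
        using x u w by (intro eq_vecI) auto
      moreover have "(a1 @\<^sub>v a2) @\<^sub>v a3 = (b1 @\<^sub>v b2) @\<^sub>v b3 \<longleftrightarrow> a1 = b1 \<and> a2 = b2 \<and> a3 = b3"
        if "a1 \<in> carrier_vec n" "a2 \<in> carrier_vec p" "b1 \<in> carrier_vec n" "b2 \<in> carrier_vec p"
        for a1 a2 a3 b1 b2 b3 :: "complex vec"
        using append_vec_eq[of "a1 @\<^sub>v a2" "n + p" "b1 @\<^sub>v b2" a3 b3] append_vec_eq[of a1 n b1 a2 b2] that
        by simp
      ultimately have "?M *\<^sub>v ((x @\<^sub>v u) @\<^sub>v w) = (1 / y) \<cdot>\<^sub>v ((x @\<^sub>v u) @\<^sub>v w) \<longleftrightarrow>
          x + h \<cdot>\<^sub>v ?k2 x - ?k1 x - h \<cdot>\<^sub>v ?k3 u + (g * D) *\<^sub>v w = (1 / y) \<cdot>\<^sub>v x \<and>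
          h \<cdot>\<^sub>v (C *\<^sub>v x) + u = (1 / y) \<cdot>\<^sub>v u \<and> C *\<^sub>v x = (1 / y) \<cdot>\<^sub>v w"
        unfolding Mv[OF x u w] using k[OF x u] kw x u by simp
      then show ?thesis
        using g C x u w by (simp add: vec_eq_iff del: index_mult_mat_vec assoc_mult_mat_vec)
    qed
    have delay: "(\<forall>i<p. (C *\<^sub>v x) $ i = 1 / y * w $ i) \<longleftrightarrow> w = y \<cdot>\<^sub>v (C *\<^sub>v x)"
      using y C w by (auto simp: vec_eq_iff field_simps simp del: index_mult_mat_vec)
    have "((\<forall>i<n. x $ i + h * ?k2 x $ i - ?k1 x $ i - h * ?k3 u $ i + ((g * D) *\<^sub>v w) $ i = 1 / y * x $ i) \<and>
      (\<forall>i<p. h * (C *\<^sub>v x) $ i + u $ i = 1 / y * u $ i) \<and> w = y \<cdot>\<^sub>v (C *\<^sub>v x)) \<longleftrightarrow>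
      w = y \<cdot>\<^sub>v (C *\<^sub>v x) \<and> ?T *\<^sub>v (x @\<^sub>v u) = 0\<^sub>v (n + p)"
    proof (cases "w = y \<cdot>\<^sub>v (C *\<^sub>v x)")
      case True
      have "(g * D) *\<^sub>v w = y \<cdot>\<^sub>v ?k1 x"
        unfolding True using g D k(4)[OF x u] by (intro mult_mat_vec) auto
      then have gDw: "((g * D) *\<^sub>v w) $ i = y * ?k1 x $ i" if "i < n" for i
        using that g by (simp del: index_mult_mat_vec assoc_mult_mat_vec)
      have eq1: "a + h * b - c - h * d + y * c = 1 / y * a \<longleftrightarrow>
          (1 - y) * a + (1 - y) * y * c - h * y * b + h * y * d = 0" for a b c d :: complex
      proof -
        have "a + h * b - c - h * d + y * c = 1 / y * a \<longleftrightarrow> y * (a + h * b - c - h * d + y * c) = a"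
          using y by (simp add: field_simps)
        also have "\<dots> \<longleftrightarrow> (1 - y) * a + (1 - y) * y * c - h * y * b + h * y * d = 0"
          unfolding eq_iff_diff_eq_0[where b = a] by (auto simp: algebra_simps)
        finally show ?thesis .
      qed
      have eq2: "h * c + a = 1 / y * a \<longleftrightarrow> (1 - y) * a - h * y * c = 0" for a c :: complex
        using y by (auto simp: field_simps)
      show ?thesis
        unfolding Tv[OF x u] using True gDw by (simp add: eq1[simplified] eq2[simplified] del: index_mult_mat_vec)
    qed simp
    then show ?thesis unfolding entries delay .
  qed
  show ?thesis
  proof
    assume "eigenvalue ?M (1 / y)"
    then obtain v where v: "v \<in> carrier_vec (n + p + p)" "v \<noteq> 0\<^sub>v (n + p + p)"
      and ev: "?M *\<^sub>v v = (1 / y) \<cdot>\<^sub>v v"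
      using M unfolding eigenvalue_def eigenvector_def by auto
    define x where "x = vec_first (vec_first v (n + p)) n"
    define u where "u = vec_last (vec_first v (n + p)) p"
    define w where "w = vec_last v p"
    have xuw: "x \<in> carrier_vec n" "u \<in> carrier_vec p" "w \<in> carrier_vec p"
      by (simp_all add: x_def u_def w_def)
    have "vec_first v (n + p) \<in> carrier_vec (n + p)" by simp
    then have v_eq: "v = (x @\<^sub>v u) @\<^sub>v w"
      using v(1) by (simp add: x_def u_def w_def)
    note * = ev[unfolded v_eq Mev[OF xuw]]
    have "x @\<^sub>v u \<noteq> 0\<^sub>v (n + p)"
    proof
      assume 0: "x @\<^sub>v u = 0\<^sub>v (n + p)"
      then have "x = 0\<^sub>v n" using append_vec_eq_zero_iff xuw by blast
      then have "C *\<^sub>v x = 0\<^sub>v p" using C by (intro eq_vecI) auto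
      then have "w = 0\<^sub>v p" using * by (auto intro!: eq_vecI)
      then have "v = 0\<^sub>v (n + p + p)" unfolding v_eq 0 by (intro eq_vecI) auto
      with v(2) show False ..
    qed
    moreover have "x @\<^sub>v u \<in> carrier_vec (n + p)" using xuw by simp
    ultimately show "det ?T = 0"
      using * unfolding det_0_iff_vec_prod_zero_field[OF T] by blast
  next
    assume "det ?T = 0"
    then obtain v where v: "v \<in> carrier_vec (n + p)" "v \<noteq> 0\<^sub>v (n + p)" and ker: "?T *\<^sub>v v = 0\<^sub>v (n + p)"
      unfolding det_0_iff_vec_prod_zero_field[OF T] by blast
    define x where "x = vec_first v n"
    define u where "u = vec_last v p"
    define w where "w = y \<cdot>\<^sub>v (C *\<^sub>v x)"
    have xu: "x \<in> carrier_vec n" "u \<in> carrier_vec p" by (simp_all add: x_def u_def)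
    have w: "w \<in> carrier_vec p" unfolding w_def using k[OF xu] by simp
    have v_eq: "v = x @\<^sub>v u" using v(1) by (simp add: x_def u_def)
    have "?M *\<^sub>v (v @\<^sub>v w) = (1 / y) \<cdot>\<^sub>v (v @\<^sub>v w)"
      using ker unfolding v_eq Mev[OF xu w] by (simp add: w_def)
    moreover have "v @\<^sub>v w \<noteq> 0\<^sub>v (n + p + p)"
    proof
      assume "v @\<^sub>v w = 0\<^sub>v (n + p + p)"
      then have "v = 0\<^sub>v (n + p)" using append_vec_eq_zero_iff v(1) w by blast
      with v(2) show False ..
    qed
    ultimately show "eigenvalue ?M (1 / y)"
      unfolding eigenvalue_def eigenvector_def using M v(1) w
      by (intro exI[of _ "v @\<^sub>v w"]) auto
  qed
qed

section \<open>Eigenvalues of the two limit matrices\<close>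

text \<open>The slow limit of the pencil is \<open>s (1 + L) - R = (1 + L) (s - M)\<close>.\<close>
lemma eigenvalue_iff_pencil_slow:
  assumes L: "L \<in> carrier_mat N N" and M: "M \<in> carrier_mat N N"
    and R: "R = (1\<^sub>m N + L) * M" and nonsing: "det (1\<^sub>m N + L) \<noteq> 0"
  shows "eigenvalue M s \<longleftrightarrow> det (pencil (1\<^sub>m N) L R 1 s 1) = 0"
proof -
  let ?F = "1\<^sub>m N + L"
  have F: "?F \<in> carrier_mat N N" using L by simp
  have FM: "?F * M \<in> carrier_mat N N" using F M by simp
  have cM: "char_matrix M s \<in> carrier_mat N N" using M by simp
  have "?F * char_matrix M s = ?F * M + ?F * ((- s) \<cdot>\<^sub>m 1\<^sub>m N)"
    using F M unfolding char_matrix_def by (subst mult_add_distrib_mat[of _ N N]) auto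
  also have "?F * ((- s) \<cdot>\<^sub>m 1\<^sub>m N) = (- s) \<cdot>\<^sub>m ?F"
    using mult_smult_distrib[OF F one_carrier_mat, of "- s"] right_mult_one_mat[OF F] by simp
  finally have prod: "?F * char_matrix M s = ?F * M + (- s) \<cdot>\<^sub>m ?F" .
  have "pencil (1\<^sub>m N) L R 1 s 1 = s \<cdot>\<^sub>m 1\<^sub>m N + (s \<cdot>\<^sub>m L - 1 \<cdot>\<^sub>m R)"
    using L FM unfolding pencil_def R by simp
  also have "\<dots> = (- 1) \<cdot>\<^sub>m (?F * char_matrix M s)"
    unfolding prod R using FM L by (intro eq_matI) (auto simp: algebra_simps)
  finally have "det (pencil (1\<^sub>m N) L R 1 s 1)
      = (- 1) ^ N * (det ?F * det (char_matrix M s))"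
    using det_mult[OF F cM] cM L F by simp
  then show ?thesis
    using nonsing eigenvalue_det[OF M, of s] by simp
qed

text \<open>The fast limit of the pencil is \<open>1 + y L\<close>, whose determinant vanishes exactly when that of
\<open>1 + y D C\<close> does. The nonzero eigenvalues of \<open>D C\<close> and \<open>C D\<close> agree: \<open>C\<close> and \<open>D\<close> carry eigenvectors
of one product to eigenvectors of the other.\<close>
lemma eigenvalue_iff_pencil_fast:
  assumes D: "D \<in> carrier_mat n p" and P: "P \<in> carrier_mat n n" and I: "I \<in> carrier_mat n p"
    and C: "C \<in> carrier_mat p n" and y: "y \<noteq> 0"
  shows "eigenvalue (C * D) (- (1 / y)) \<longleftrightarrow>
    det (pencil (1\<^sub>m (n + p)) (deriv_block D C) (pi_block P I C) y 1 0) = 0"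
proof -
  let ?T = "pencil (1\<^sub>m (n + p)) (deriv_block D C) (pi_block P I C) y 1 0"
  have T: "?T \<in> carrier_mat (n + p) (n + p)"
    by (rule pencil_carrier) (use D P C in auto)
  have Tv: "?T *\<^sub>v (x @\<^sub>v u) = 0\<^sub>v (n + p) \<longleftrightarrow> x + y \<cdot>\<^sub>v (D *\<^sub>v (C *\<^sub>v x)) = 0\<^sub>v n \<and> u = 0\<^sub>v p"
    if x: "x \<in> carrier_vec n" and u: "u \<in> carrier_vec p" for x u
  proof -
    have "?T *\<^sub>v (x @\<^sub>v u) = (x + y \<cdot>\<^sub>v (D *\<^sub>v (C *\<^sub>v x))) @\<^sub>v u"
      unfolding hold_block_one[symmetric] pencil_mult_append[OF one_carrier_mat D P I C x u]
      using D P I C x u by (intro eq_vecI) auto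
    then show ?thesis
      using append_vec_eq_zero_iff[of "x + y \<cdot>\<^sub>v (D *\<^sub>v (C *\<^sub>v x))" n u p] x u D C by simp
  qed
  have "det ?T = 0 \<longleftrightarrow>
      (\<exists>x. x \<in> carrier_vec n \<and> x \<noteq> 0\<^sub>v n \<and> x + y \<cdot>\<^sub>v (D *\<^sub>v (C *\<^sub>v x)) = 0\<^sub>v n)" (is "_ \<longleftrightarrow> ?ker")
  proof
    assume "det ?T = 0"
    then obtain v where v: "v \<in> carrier_vec (n + p)" "v \<noteq> 0\<^sub>v (n + p)" "?T *\<^sub>v v = 0\<^sub>v (n + p)"
      unfolding det_0_iff_vec_prod_zero_field[OF T] by blast
    have v_eq: "v = vec_first v n @\<^sub>v vec_last v p" using v(1) by simp
    have "vec_first v n \<noteq> 0\<^sub>v n \<and> vec_first v n + y \<cdot>\<^sub>v (D *\<^sub>v (C *\<^sub>v vec_first v n)) = 0\<^sub>v n"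
      using v(2,3) Tv[of "vec_first v n" "vec_last v p"]
        append_vec_eq_zero_iff[of "vec_first v n" n "vec_last v p" p]
      unfolding v_eq[symmetric] by auto
    then show ?ker using vec_first_carrier[of v n] by blast
  next
    assume ?ker
    then obtain x where x: "x \<in> carrier_vec n" "x \<noteq> 0\<^sub>v n" "x + y \<cdot>\<^sub>v (D *\<^sub>v (C *\<^sub>v x)) = 0\<^sub>v n" by blast
    then have "x @\<^sub>v 0\<^sub>v p \<in> carrier_vec (n + p) \<and> x @\<^sub>v 0\<^sub>v p \<noteq> 0\<^sub>v (n + p) \<and> ?T *\<^sub>v (x @\<^sub>v 0\<^sub>v p) = 0\<^sub>v (n + p)"
      using Tv[of x "0\<^sub>v p"] append_vec_eq_zero_iff[of x n "0\<^sub>v p" p] by auto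
    then show "det ?T = 0"
      unfolding det_0_iff_vec_prod_zero_field[OF T] by blast
  qed
  also have "?ker \<longleftrightarrow> eigenvalue (C * D) (- (1 / y))"
  proof
    assume ?ker
    then obtain x where x: "x \<in> carrier_vec n" "x \<noteq> 0\<^sub>v n" and ker: "x + y \<cdot>\<^sub>v (D *\<^sub>v (C *\<^sub>v x)) = 0\<^sub>v n" by blast
    define w where "w = C *\<^sub>v x"
    have w: "w \<in> carrier_vec p" using C x by (simp add: w_def)
    have Dw: "D *\<^sub>v w \<in> carrier_vec n" using D w by simp
    have x_eq: "x = (- y) \<cdot>\<^sub>v (D *\<^sub>v w)"
    proof (rule eq_vecI)
      fix i assume "i < dim_vec ((- y) \<cdot>\<^sub>v (D *\<^sub>v w))"
      then show "x $ i = ((- y) \<cdot>\<^sub>v (D *\<^sub>v w)) $ i"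
        using arg_cong[OF ker, of "\<lambda>v. v $ i"] x(1) Dw D unfolding w_def[symmetric]
        by (simp add: eq_neg_iff_add_eq_0 del: index_mult_mat_vec)
    qed (use x(1) D in simp)
    have "w = (- y) \<cdot>\<^sub>v (C *\<^sub>v (D *\<^sub>v w))"
      using mult_mat_vec[OF C Dw, of "- y"] unfolding x_eq[symmetric] w_def[symmetric] .
    then have "(- (1 / y)) \<cdot>\<^sub>v w = (- (1 / y)) \<cdot>\<^sub>v ((- y) \<cdot>\<^sub>v (C *\<^sub>v (D *\<^sub>v w)))" by simp
    also have "\<dots> = (C * D) *\<^sub>v w"
      using y C D w by (simp add: smult_smult_assoc)
    finally have "(C * D) *\<^sub>v w = (- (1 / y)) \<cdot>\<^sub>v w" ..
    moreover have "w \<noteq> 0\<^sub>v p"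
    proof
      assume "w = 0\<^sub>v p"
      then have "x = 0\<^sub>v n" unfolding x_eq using D by (intro eq_vecI) auto
      with x(2) show False ..
    qed
    ultimately show "eigenvalue (C * D) (- (1 / y))"
      unfolding eigenvalue_def eigenvector_def using w C by auto
  next
    assume "eigenvalue (C * D) (- (1 / y))"
    then obtain w where w: "w \<in> carrier_vec p" "w \<noteq> 0\<^sub>v p" and ev: "(C * D) *\<^sub>v w = (- (1 / y)) \<cdot>\<^sub>v w"
      using C unfolding eigenvalue_def eigenvector_def by auto
    define x where "x = D *\<^sub>v w"
    have x: "x \<in> carrier_vec n" using D w by (simp add: x_def)
    have Cx: "C *\<^sub>v x = (- (1 / y)) \<cdot>\<^sub>v w" using ev C D w by (simp add: x_def)
    have "D *\<^sub>v (C *\<^sub>v x) = (- (1 / y)) \<cdot>\<^sub>v x"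
      unfolding Cx unfolding x_def by (rule mult_mat_vec[OF D w(1)])
    then have "x + y \<cdot>\<^sub>v (D *\<^sub>v (C *\<^sub>v x)) = 0\<^sub>v n"
      using x y by (intro eq_vecI) auto
    moreover have "x \<noteq> 0\<^sub>v n"
    proof
      assume "x = 0\<^sub>v n"
      then have "C *\<^sub>v x = 0\<^sub>v p" using C by (intro eq_vecI) auto
      then have "(- (1 / y)) \<cdot>\<^sub>v w = 0\<^sub>v p" unfolding Cx .
      then have "(- y) \<cdot>\<^sub>v ((- (1 / y)) \<cdot>\<^sub>v w) = (- y) \<cdot>\<^sub>v 0\<^sub>v p" by simp
      also have "\<dots> = 0\<^sub>v p" by (intro eq_vecI) auto
      finally have "w = 0\<^sub>v p" using y by (simp add: smult_smult_assoc)
      with w(2) show False ..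
    qed
    ultimately show ?ker using x by blast
  qed
  finally show ?thesis by blast
qed

lemma the_mat_inverse:
  fixes E :: "real mat"
  assumes E: "E \<in> carrier_mat n n" and inv: "invertible_mat E"
  shows "the (mat_inverse E) \<in> carrier_mat n n" "E * the (mat_inverse E) = 1\<^sub>m n"
proof -
  obtain F where F: "E * F = 1\<^sub>m n" "F * E = 1\<^sub>m (dim_row F)"
    using inv E unfolding invertible_mat_def inverts_mat_def by auto
  have "dim_col F = n" using arg_cong[OF F(1), of dim_col] by simp
  moreover have "dim_row F = n" using arg_cong[OF F(2), of dim_col] E by simp
  ultimately have "F \<in> carrier_mat n n" by auto
  then have "E \<in> Units (ring_mat TYPE(real) n ())"
    using E F unfolding Units_def ring_mat_def by auto
  then obtain X where "mat_inverse E = Some X"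
    using mat_inverse(1)[OF E, of "()"] by (cases "mat_inverse E") blast+
  with mat_inverse(2)[OF E this]
  show "the (mat_inverse E) \<in> carrier_mat n n" "E * the (mat_inverse E) = 1\<^sub>m n" by auto
qed

text \<open>Here \<open>1 + L = diag(E, 1)\<close>, which cancels the factor \<open>E\<^sup>-\<^sup>1\<close> in the upper blocks of the ideal
closed loop.\<close>
lemma A_id_factorization:
  assumes A: "A \<in> carrier_mat n n" and B: "B \<in> carrier_mat n m" and C: "C \<in> carrier_mat p n"
    and KP: "KP \<in> carrier_mat m p" and KI: "KI \<in> carrier_mat m p" and KD: "KD \<in> carrier_mat m p"
    and inv: "invertible_mat (E_mat B C KD)"
  defines "L \<equiv> deriv_block (cmat (B * KD)) (cmat C)"
    and "R \<equiv> pi_block (cmat (A - B * KP * C)) (cmat (B * KI)) (cmat C)"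
  shows "cmat (A_id A B C KP KI KD) \<in> carrier_mat (n + p) (n + p)"
    and "(1\<^sub>m (n + p) + L) * cmat (A_id A B C KP KI KD) = R"
    and "det (1\<^sub>m (n + p) + L) \<noteq> 0"
proof -
  let ?E = "E_mat B C KD" and ?P = "A - B * KP * C" and ?I = "B * KI"
  define X where "X = the (mat_inverse ?E)"
  have BKDC: "B * KD * C \<in> carrier_mat n n" by (rule mult_carrier_mat[OF mult_carrier_mat[OF B KD] C])
  have E: "?E \<in> carrier_mat n n" using add_carrier_mat[OF BKDC, of "1\<^sub>m n"] B by (simp add: E_mat_def)
  have X: "X \<in> carrier_mat n n" and EX: "?E * X = 1\<^sub>m n"
    using the_mat_inverse[OF E inv] by (simp_all add: X_def)
  have P: "?P \<in> carrier_mat n n" by (rule minus_carrier_mat[OF mult_carrier_mat[OF mult_carrier_mat[OF B KP] C]])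
  have I: "?I \<in> carrier_mat n p" by (rule mult_carrier_mat[OF B KI])
  let ?F = "four_block_mat ?E (0\<^sub>m n p) (0\<^sub>m p n) (1\<^sub>m p)"
  have F: "?F \<in> carrier_mat (n + p) (n + p)" using E by simp
  have F_eq: "1\<^sub>m (n + p) + L = cmat ?F"
  proof -
    have "cmat (B * KD) * cmat C = cmat (B * KD * C)"
      using B KD C by (intro of_real_hom.mat_hom_mult[symmetric]) auto
    then show ?thesis
      unfolding L_def deriv_block_def E_mat_def using BKDC B C KD
      by (intro eq_matI) (auto simp del: assoc_mult_mat index_mult_mat(1))
  qed
  have id: "A_id A B C KP KI KD = four_block_mat (X * ?P) (- (X * ?I)) C (0\<^sub>m p p)"
    using X B KI C by (simp add: A_id_def Let_def X_def[symmetric] assoc_mult_mat[of X n n B m KI p])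
  have idc: "A_id A B C KP KI KD \<in> carrier_mat (n + p) (n + p)"
    unfolding id using X P by simp
  then show "cmat (A_id A B C KP KI KD) \<in> carrier_mat (n + p) (n + p)" by simp
  have EXQ: "?E * (X * Q) = Q" if "Q \<in> carrier_mat n q" for Q q
    using assoc_mult_mat[OF E X that] EX that by simp
  have XI: "X * ?I \<in> carrier_mat n p" and XP: "X * ?P \<in> carrier_mat n n"
    by (rule mult_carrier_mat[OF X I], rule mult_carrier_mat[OF X P])
  have "?F * A_id A B C KP KI KD = four_block_mat
      (?E * (X * ?P) + 0\<^sub>m n p * C) (?E * (- (X * ?I)) + 0\<^sub>m n p * 0\<^sub>m p p)
      (0\<^sub>m p n * (X * ?P) + 1\<^sub>m p * C) (0\<^sub>m p n * (- (X * ?I)) + 1\<^sub>m p * 0\<^sub>m p p)"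
    unfolding id
    by (rule mult_four_block_mat[OF E zero_carrier_mat zero_carrier_mat one_carrier_mat XP
          uminus_carrier_iff_mat[THEN iffD2, OF XI] C zero_carrier_mat])
  also have "?E * (- (X * ?I)) = - ?I"
    using uminus_mult_right_mat[of ?E "X * ?I"] E X XI unfolding EXQ[OF I] by simp
  also have "?E * (X * ?P) = ?P" by (rule EXQ[OF P])
  finally have prod: "?F * A_id A B C KP KI KD = four_block_mat ?P (- ?I) C (0\<^sub>m p p)"
    using P I C left_mult_zero_mat[OF XP, of p] left_mult_zero_mat[OF C, of n]
      left_mult_zero_mat[OF uminus_carrier_iff_mat[THEN iffD2, OF XI], of p]
    by simp
  have "(1\<^sub>m (n + p) + L) * cmat (A_id A B C KP KI KD) = cmat (?F * A_id A B C KP KI KD)"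
    unfolding F_eq by (rule of_real_hom.mat_hom_mult[OF F idc, symmetric])
  also have "\<dots> = R"
  proof -
    have "cmat (- Y) = - cmat Y" for Y by (intro eq_matI) auto
    moreover have "cmat (0\<^sub>m p p) = 0\<^sub>m p p" by (intro eq_matI) auto
    ultimately show ?thesis
      unfolding prod R_def pi_block_def
        map_four_block_mat[OF P uminus_carrier_mat[OF I] C zero_carrier_mat] using C by simp
  qed
  finally show "(1\<^sub>m (n + p) + L) * cmat (A_id A B C KP KI KD) = R" .
  have "det ?E * det X = 1"
    using det_mult[OF E X] EX by simp
  moreover have "det ?F = det ?E * det (1\<^sub>m p)"
    by (rule det_four_block_mat_upper_right_zero[OF E]) auto
  ultimately have "det ?F \<noteq> 0" by auto
  then show "det (1\<^sub>m (n + p) + L) \<noteq> 0" unfolding F_eq by simp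
qed

section \<open>Stability for small sampling periods\<close>

text \<open>The eigenvalues \<open>z\<close> outside the open unit disk are the numbers \<open>1 / y\<close> with \<open>0 < \<bar>y\<bar> \<le> 1\<close>.\<close>
lemma not_schur_lift_iff_pencil:
  assumes A: "A \<in> carrier_mat n n" and B: "B \<in> carrier_mat n m" and C: "C \<in> carrier_mat p n"
    and KP: "KP \<in> carrier_mat m p" and KI: "KI \<in> carrier_mat m p" and KD: "KD \<in> carrier_mat m p"
    and h: "h > 0"
  shows "\<not> schur (A_lift A B C KP KI KD h) \<longleftrightarrow> (\<exists>y. y \<noteq> 0 \<and> cmod y \<le> 1 \<and>
    det (pencil (hold_block (cmat (phi1 A h)) p) (deriv_block (cmat (B * KD)) (cmat C))
      (pi_block (cmat (A - B * KP * C)) (cmat (B * KI)) (cmat C)) y (1 - y) (complex_of_real h * y)) = 0)"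
proof -
  have g: "phi1 A h \<in> carrier_mat n n" by (rule phi1_carrier[OF A])
  have D: "B * KD \<in> carrier_mat n p" by (rule mult_carrier_mat[OF B KD])
  have P: "A - B * KP * C \<in> carrier_mat n n"
    by (rule minus_carrier_mat[OF mult_carrier_mat[OF mult_carrier_mat[OF B KP] C]])
  have I: "B * KI \<in> carrier_mat n p" by (rule mult_carrier_mat[OF B KI])
  have lift: "cmat (A_lift A B C KP KI KD h) = lift_blocks (cmat (phi1 A h)) (cmat (B * KD))
      (cmat (A - B * KP * C)) (cmat (B * KI)) (cmat C) (complex_of_real h)"
    unfolding A_lift_eq_lift_blocks[OF A B C KP KI KD h] by (rule cmat_lift_blocks[OF g D P I C])
  have step: "eigenvalue (cmat (A_lift A B C KP KI KD h)) (1 / y) \<longleftrightarrow>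
      det (pencil (hold_block (cmat (phi1 A h)) p) (deriv_block (cmat (B * KD)) (cmat C))
        (pi_block (cmat (A - B * KP * C)) (cmat (B * KI)) (cmat C)) y (1 - y) (complex_of_real h * y)) = 0"
    if "y \<noteq> 0" for y
    unfolding lift
    by (rule eigenvalue_lift_blocks_iff[where n = n, OF _ _ _ _ _ that])
      (simp_all only: map_carrier_mat g D P I C)
  have "\<not> schur (A_lift A B C KP KI KD h) \<longleftrightarrow>
      (\<exists>y. y \<noteq> 0 \<and> cmod y \<le> 1 \<and> eigenvalue (cmat (A_lift A B C KP KI KD h)) (1 / y))"
  proof
    assume "\<not> schur (A_lift A B C KP KI KD h)"
    then obtain z where z: "eigenvalue (cmat (A_lift A B C KP KI KD h)) z" and "\<not> cmod z < 1"
      unfolding schur_def by blast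
    then have "1 / z \<noteq> 0 \<and> cmod (1 / z) \<le> 1" by (auto simp: norm_divide divide_le_eq)
    moreover have "eigenvalue (cmat (A_lift A B C KP KI KD h)) (1 / (1 / z))" using z by simp
    ultimately
    show "\<exists>y. y \<noteq> 0 \<and> cmod y \<le> 1 \<and> eigenvalue (cmat (A_lift A B C KP KI KD h)) (1 / y)" by blast
  next
    assume "\<exists>y. y \<noteq> 0 \<and> cmod y \<le> 1 \<and> eigenvalue (cmat (A_lift A B C KP KI KD h)) (1 / y)"
    then obtain y where y: "y \<noteq> 0" "cmod y \<le> 1" "eigenvalue (cmat (A_lift A B C KP KI KD h)) (1 / y)" by blast
    then have "\<not> cmod (1 / y) < 1" by (simp add: norm_divide divide_less_eq)
    with y(3) show "\<not> schur (A_lift A B C KP KI KD h)" unfolding schur_def by blast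
  qed
  also have "\<dots> \<longleftrightarrow> (\<exists>y. y \<noteq> 0 \<and> cmod y \<le> 1 \<and>
    det (pencil (hold_block (cmat (phi1 A h)) p) (deriv_block (cmat (B * KD)) (cmat C))
      (pi_block (cmat (A - B * KP * C)) (cmat (B * KI)) (cmat C)) y (1 - y) (complex_of_real h * y)) = 0)"
    using step by blast
  finally show ?thesis .
qed

theorem theorem2:
  fixes n m p :: nat and A B C KP KI KD :: "real mat"
  assumes "n > 0" and "m > 0" and "p > 0"
    and "A \<in> carrier_mat n n" and "B \<in> carrier_mat n m" and "C \<in> carrier_mat p n"
    and "KP \<in> carrier_mat m p" and "KI \<in> carrier_mat m p" and "KD \<in> carrier_mat m p"
    and "invertible_mat (E_mat B C KD)"
  shows
    "(hurwitz (A_id A B C KP KI KD) \<and> spectral_radius (cmat (M_D B C KD)) < 1 \<longrightarrow>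
        (\<exists>hs>0. \<forall>h\<in>{0<..<hs}. schur (A_lift A B C KP KI KD h)))
   \<and> ((\<exists>\<mu>. eigenvalue (cmat (A_id A B C KP KI KD)) \<mu> \<and> Re \<mu> > 0) \<or>
        (\<exists>\<mu>. eigenvalue (cmat (M_D B C KD)) \<mu> \<and> cmod \<mu> > 1) \<longrightarrow>
        (\<exists>h0>0. \<forall>h\<in>{0<..<h0}. \<not> schur (A_lift A B C KP KI KD h)))
   \<and> ((\<forall>\<mu>. eigenvalue (cmat (A_id A B C KP KI KD)) \<mu> \<longrightarrow> Re \<mu> \<noteq> 0) \<and>
        (\<forall>\<mu>. eigenvalue (cmat (M_D B C KD)) \<mu> \<longrightarrow> cmod \<mu> \<noteq> 1) \<longrightarrow>
        ((\<exists>hs>0. \<forall>h\<in>{0<..<hs}. schur (A_lift A B C KP KI KD h)) \<longleftrightarrow>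
          hurwitz (A_id A B C KP KI KD) \<and> spectral_radius (cmat (M_D B C KD)) < 1))"
proof -
  note ABC = assms(4-9)
  let ?Aid = "cmat (A_id A B C KP KI KD)" and ?MD = "cmat (M_D B C KD)"
    and ?lift = "A_lift A B C KP KI KD"
  define G where "G h = hold_block (cmat (phi1 A h)) p" for h
  define L where "L = deriv_block (cmat (B * KD)) (cmat C)"
  define R where "R = pi_block (cmat (A - B * KP * C)) (cmat (B * KI)) (cmat C)"
  have D: "cmat (B * KD) \<in> carrier_mat n p"
    unfolding map_carrier_mat by (rule mult_carrier_mat[OF ABC(2,6)])
  have P: "cmat (A - B * KP * C) \<in> carrier_mat n n"
    unfolding map_carrier_mat
    by (rule minus_carrier_mat[OF mult_carrier_mat[OF mult_carrier_mat[OF ABC(2,4)] ABC(3)]])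
  have I: "cmat (B * KI) \<in> carrier_mat n p"
    unfolding map_carrier_mat by (rule mult_carrier_mat[OF ABC(2,5)])
  have C: "cmat C \<in> carrier_mat p n"
    unfolding map_carrier_mat by (rule ABC(3))
  have G: "G h \<in> carrier_mat (n + p) (n + p)" for h using phi1_carrier[OF ABC(1)] by (simp add: G_def)
  have L: "L \<in> carrier_mat (n + p) (n + p)" and R: "R \<in> carrier_mat (n + p) (n + p)"
    unfolding L_def R_def using D P C by simp_all
  have G0: "G 0 = 1\<^sub>m (n + p)"
    using ABC phi1_0[of A n] by (simp add: G_def of_real_hom.mat_hom_one hold_block_one)
  have contG: "continuous_on UNIV (\<lambda>h. G h $$ (i, j))" if "i < n + p" "j < n + p" for i j
  proof (cases "i < n \<and> j < n")
    case True
    then have "G h $$ (i, j) = complex_of_real (phi1 A h $$ (i, j))" for h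
      using phi1_carrier[OF ABC(1), of h] by (simp add: G_def hold_block_def)
    then show ?thesis
      using continuous_on_phi1_entry[OF ABC(1)] True by (simp add: continuous_on_of_real)
  next
    case False
    then have "G h $$ (i, j) = (1\<^sub>m (n + p)) $$ (i, j)" for h
      using that phi1_carrier[OF ABC(1), of h] by (auto simp: G_def hold_block_def)
    then show ?thesis by simp
  qed
  have not_schur: "\<not> schur (?lift h) \<longleftrightarrow> (\<exists>y. y \<noteq> 0 \<and> cmod y \<le> 1 \<and>
      det (pencil (G h) L R y (1 - y) (complex_of_real h * y)) = 0)" if "h > 0" for h
    unfolding G_def L_def R_def by (rule not_schur_lift_iff_pencil[OF ABC that])
  have Aid: "?Aid \<in> carrier_mat (n + p) (n + p)" and factor: "(1\<^sub>m (n + p) + L) * ?Aid = R"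
    and nonsing: "det (1\<^sub>m (n + p) + L) \<noteq> 0"
    unfolding L_def R_def by (rule A_id_factorization[OF ABC assms(10)])+
  have slow: "eigenvalue ?Aid s \<longleftrightarrow> det (pencil (G 0) L R 1 s 1) = 0" for s
    unfolding G0 by (rule eigenvalue_iff_pencil_slow[OF L Aid factor[symmetric] nonsing])
  have MD: "?MD \<in> carrier_mat p p" using mult_carrier_mat[OF mult_carrier_mat[OF ABC(3,2)] ABC(6)]
    unfolding M_D_def map_carrier_mat .
  have fast: "eigenvalue ?MD (- (1 / y)) \<longleftrightarrow> det (pencil (G 0) L R y 1 0) = 0" if "y \<noteq> 0" for y
  proof -
    have "?MD = cmat C * cmat (B * KD)"
      unfolding M_D_def assoc_mult_mat[OF ABC(3,2,6)]
      by (rule of_real_hom.mat_hom_mult[OF ABC(3) mult_carrier_mat[OF ABC(2,6)]])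
    then show ?thesis
      using eigenvalue_iff_pencil_fast[OF D P I C that] by (simp add: G0 L_def R_def)
  qed
  have stable: "\<exists>hs>0. \<forall>h\<in>{0<..<hs}. schur (?lift h)"
    if "hurwitz (A_id A B C KP KI KD)" and rho: "spectral_radius ?MD < 1"
  proof -
    have "det (pencil (G 0) L R y 1 0) \<noteq> 0" if y: "cmod y \<le> 1" for y
    proof (cases "y = 0")
      case True
      then show ?thesis using det_pencil_fast_0[OF G L R] by simp
    next
      case False
      show ?thesis
      proof
        assume "det (pencil (G 0) L R y 1 0) = 0"
        then have "cmod (- (1 / y)) \<in> norm ` spectrum ?MD"
          unfolding spectrum_def using fast[OF False] by blast
        then have "cmod (- (1 / y)) < 1"
          using spectral_radius_mem_max(2)[OF MD \<open>p > 0\<close>] rho by fastforce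
        with y False show False by (simp add: norm_divide divide_less_eq)
      qed
    qed
    moreover have "Re s < 0" if "det (pencil (G 0) L R 1 s 1) = 0" for s
      using that slow \<open>hurwitz _\<close> unfolding hurwitz_def by blast
    ultimately obtain hs where "hs > 0" "\<forall>h\<in>{0<..<hs}. \<forall>y. y \<noteq> 0 \<and> cmod y \<le> 1 \<longrightarrow>
        det (pencil (G h) L R y (1 - y) (complex_of_real h * y)) \<noteq> 0"
      using pencil_no_zero[OF G L R contG] by blast
    then show ?thesis using not_schur by (metis greaterThanLessThan_iff)
  qed
  have unstable: "\<exists>h0>0. \<forall>h\<in>{0<..<h0}. \<not> schur (?lift h)"
    if "(\<exists>\<mu>. eigenvalue ?Aid \<mu> \<and> Re \<mu> > 0) \<or> (\<exists>\<mu>. eigenvalue ?MD \<mu> \<and> cmod \<mu> > 1)"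
  proof -
    have "\<exists>h0>0. \<forall>h\<in>{0<..<h0}. \<exists>y. y \<noteq> 0 \<and> cmod y < 1 \<and>
        det (pencil (G h) L R y (1 - y) (complex_of_real h * y)) = 0"
      using that
    proof
      assume "\<exists>\<mu>. eigenvalue ?Aid \<mu> \<and> Re \<mu> > 0"
      then obtain s where s: "det (pencil (G 0) L R 1 s 1) = 0" "Re s > 0"
        using slow by blast
      have "pencil (G 0) L R 1 1 0 = 1\<^sub>m (n + p) + L"
        unfolding G0 pencil_def using L R by (intro eq_matI) (auto simp: left_mult_one_mat[of _ _ "n + p"])
      with nonsing have "det (pencil (G 0) L R 1 1 0) \<noteq> 0" by simp
      then show ?thesis using pencil_slow_zero[OF G L R contG _ s] by blast
    next
      assume "\<exists>\<mu>. eigenvalue ?MD \<mu> \<and> cmod \<mu> > 1"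
      then obtain \<mu> where mu: "eigenvalue ?MD \<mu>" "cmod \<mu> > 1" by blast
      define y where "y = - (1 / \<mu>)"
      have y: "y \<noteq> 0" "cmod y < 1" "- (1 / y) = \<mu>"
        using mu(2) by (auto simp: y_def norm_divide divide_less_eq)
      then show ?thesis using pencil_fast_zero[OF G L R contG _ y(2)] fast[OF y(1)] mu(1) by simp
    qed
    then show ?thesis using not_schur by (metis greaterThanLessThan_iff less_imp_le)
  qed
  have not_both: False
    if small: "\<exists>hs>0. \<forall>h\<in>{0<..<hs}. schur (?lift h)" "\<exists>h0>0. \<forall>h\<in>{0<..<h0}. \<not> schur (?lift h)"
  proof -
    obtain hs where hs: "hs > 0" "\<forall>h\<in>{0<..<hs}. schur (?lift h)" using small(1) by blast
    obtain h0 where h0: "h0 > 0" "\<forall>h\<in>{0<..<h0}. \<not> schur (?lift h)" using small(2) by blast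
    have "min hs h0 / 2 \<in> {0<..<hs}" "min hs h0 / 2 \<in> {0<..<h0}" using hs(1) h0(1) by auto
    then show False using hs(2) h0(2) by blast
  qed
  have necessary: "hurwitz (A_id A B C KP KI KD) \<and> spectral_radius ?MD < 1"
    if hyp: "\<forall>\<mu>. eigenvalue ?Aid \<mu> \<longrightarrow> Re \<mu> \<noteq> 0" "\<forall>\<mu>. eigenvalue ?MD \<mu> \<longrightarrow> cmod \<mu> \<noteq> 1"
      and sch: "\<exists>hs>0. \<forall>h\<in>{0<..<hs}. schur (?lift h)"
  proof
    have no_slow: "\<not> Re \<mu> > 0" if "eigenvalue ?Aid \<mu>" for \<mu> using that unstable not_both sch by blast
    have no_fast: "\<not> cmod \<mu> > 1" if "eigenvalue ?MD \<mu>" for \<mu> using that unstable not_both sch by blast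
    show "hurwitz (A_id A B C KP KI KD)"
      unfolding hurwitz_def using no_slow hyp(1) by (meson linorder_neqE)
    obtain \<mu> where "eigenvalue ?MD \<mu>" "spectral_radius ?MD = cmod \<mu>"
      using spectral_radius_mem_max(1)[OF MD \<open>p > 0\<close>] unfolding spectrum_def by auto
    then show "spectral_radius ?MD < 1" using no_fast hyp(2) by (metis linorder_neqE)
  qed
  show ?thesis using stable unstable necessary by blast
qed

end
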